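(* Let $\mathcal{G}$ be a triangular category over an algebraically closed field $\mathbf{k}$, with a fixed admissible order, and let $\lambda\in\Lambda$ be a weight. The costandard module $\nabla_\lambda$ has a unique simple submodule. It is isomorphic to $L_\lambda$, and every simple constituent of $\nabla_\lambda/L_\lambda$ has the form $L_\mu$ with $\mu>\lambda$.
   Context: Triangular categories. A subcategory is wide if it contains all objects. Write $|\mathcal{G}|$ for the set of isomorphism classes of objects of $\mathcal{G}$. Given a partial order $\le$ on $|\mathcal G|$, a wide subcategory is upwards (resp. downwards) if existence of a non-zero morphism $x\to y$ in it implies $x\le y$ (resp. $x\ge y$). A triangular category is a $\mathbf{k}$-linear category $\mathcal{G}$ together with a pair $(\mathcal{U},\mathcal{D})$ of wide subcategories such that: (T0) $\mathcal{G}$ is essentially small and all Hom spaces are finite dimensional; (T1) $\mathrm{End}_{\mathcal{U}}(x)=\mathrm{End}_{\mathcal{D}}(x)$ for all objects $x$, and this ring is semi-simple; (T2) there is a partial order $\le$ on $|\mathcal{G}|$ (called an admissible order) such that for every $x$ there are only finitely many $y\le x$, $\mathcal{U}$ is upwards, and $\mathcal{D}$ is downwards; (T3) for all $x,z\in\mathcal{G}$ the map $\bigoplus_{y\in|\mathcal{G}|}\mathrm{Hom}_{\mathcal{U}}(y,z)\otimes_{\mathrm{End}_{\mathcal{U}}(y)}\mathrm{Hom}_{\mathcal{D}}(x,y)\to\mathrm{Hom}_{\mathcal{G}}(x,z)$ induced by composition is an isomorphism. Put $\mathcal{M}=\mathcal{U}\cap\mathcal{D}$. Modules. For a $\mathbf{k}$-linear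 category $\mathcal{C}$, a $\mathcal{C}$-module is a $\mathbf{k}$-linear functor from $\mathcal{C}$ to $\mathbf{k}$-vector spaces. For a $\mathbf{k}$-linear functor $f$, $f^*$ denotes restriction of modules along $f$, $f_!$ its left adjoint and $f_*$ its right adjoint. Let $i\colon\mathcal{U}\to\mathcal{G}$ and $j\colon\mathcal{D}\to\mathcal{G}$ be the inclusions. Weights. $\Lambda$ is the set of isomorphism classes of simple $\mathcal{M}$-modules; its elements are called weights. $S_\lambda$ is a representative of $\lambda\in\Lambda$; it is non-zero on a unique isomorphism class $\mathrm{supp}(\lambda)\in|\mathcal{G}|$. Put $\lambda<\mu$ if $\mathrm{supp}(\lambda)<\mathrm{supp}(\mu)$. $S_\lambda$ is regarded as a $\mathcal{U}$- or $\mathcal{D}$-module by letting all maps between non-isomorphic objects act by zero. The standard module is $\Delta_\lambda=j_!(S_\lambda)$, $L_\lambda$ is its unique simple quotient, and the costandard module is $\nabla_\lambda=i_*(S_\lambda)$. A simple constituent of a module is a simple module isomorphic to a subquotient of it.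
   Formalization: A triangular category is additionally required to satisfy: objects isomorphic in G are isomorphic in M = U ∩ D. This does not follow from (T0)–(T3), but without it S_λ need not extend to a U- or D-module, so Δ_λ and ∇_λ are undefined. *)

theory Defs
  imports
    "HOL-Computational_Algebra.Polynomial"
    "HOL-Library.Poly_Mapping"
    "HOL-Library.FuncSet"
begin

section \<open>Linear categories\<close>

text \<open>
  The objects of a category are all elements of the type \<open>'o\<close>, so every category here is small.
  Its Hom spaces are subspaces of one ambient vector space \<open>('m, smul)\<close> over \<open>'k\<close> (for instance the
  direct sum of all Hom spaces).  They need not be disjoint, which is why composition and the action
  on modules carry the objects as arguments: \<open>cmp C x y z g f\<close> is the composite
  \<open>g \<circ> f\<close> of \<open>f \<in> hom C x y\<close> and \<open>g \<in> hom C y z\<close>.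
\<close>

record ('k, 'o, 'm) lincat =
  smul :: "'k \<Rightarrow> 'm \<Rightarrow> 'm"
  hom :: "'o \<Rightarrow> 'o \<Rightarrow> 'm set"
  idt :: "'o \<Rightarrow> 'm"
  cmp :: "'o \<Rightarrow> 'o \<Rightarrow> 'o \<Rightarrow> 'm \<Rightarrow> 'm \<Rightarrow> 'm"

definition linear_category :: "('k::field, 'o, 'm::ab_group_add) lincat \<Rightarrow> bool" where
  "linear_category C \<longleftrightarrow>
     vector_space (smul C) \<and>
     (\<forall>x y. module.subspace (smul C) (hom C x y)) \<and>
     (\<forall>x. idt C x \<in> hom C x x) \<and>
     (\<forall>x y z. \<forall>f\<in>hom C x y. \<forall>g\<in>hom C y z. cmp C x y z g f \<in> hom C x z) \<and>
     (\<forall>x y. \<forall>f\<in>hom C x y. cmp C x x y f (idt C x) = f \<and> cmp C x y y (idt C y) f = f) \<and>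
     (\<forall>w x y z. \<forall>f\<in>hom C w x. \<forall>g\<in>hom C x y. \<forall>h\<in>hom C y z.
        cmp C w y z h (cmp C w x y g f) = cmp C w x z (cmp C x y z h g) f) \<and>
     (\<forall>x y z. \<forall>f\<in>hom C x y. \<forall>f'\<in>hom C x y. \<forall>g\<in>hom C y z.
        cmp C x y z g (f + f') = cmp C x y z g f + cmp C x y z g f') \<and>
     (\<forall>x y z. \<forall>f\<in>hom C x y. \<forall>g\<in>hom C y z. \<forall>g'\<in>hom C y z.
        cmp C x y z (g + g') f = cmp C x y z g f + cmp C x y z g' f) \<and>
     (\<forall>x y z. \<forall>f\<in>hom C x y. \<forall>g\<in>hom C y z. \<forall>a.
        cmp C x y z g (smul C a f) = smul C a (cmp C x y z g f) \<and>
        cmp C x y z (smul C a g) f = smul C a (cmp C x y z g f))"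

definition isomorphic :: "('k, 'o, 'm) lincat \<Rightarrow> 'o \<Rightarrow> 'o \<Rightarrow> bool" where
  "isomorphic C x y \<longleftrightarrow>
     (\<exists>f\<in>hom C x y. \<exists>g\<in>hom C y x. cmp C x y x g f = idt C x \<and> cmp C y x y f g = idt C y)"

definition iso_class :: "('k, 'o, 'm) lincat \<Rightarrow> 'o \<Rightarrow> 'o set" where
  "iso_class C x = {y. isomorphic C x y}"

definition iso_classes :: "('k, 'o, 'm) lincat \<Rightarrow> 'o set set" where
  "iso_classes C = range (iso_class C)"

text \<open>A wide (linear) subcategory of \<open>C\<close> is given by its family \<open>H\<close> of Hom spaces.\<close>

definition subcat :: "('k, 'o, 'm) lincat \<Rightarrow> ('o \<Rightarrow> 'o \<Rightarrow> 'm set) \<Rightarrow> ('k, 'o, 'm) lincat" where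
  "subcat C H = C\<lparr>hom := H\<rparr>"

definition wide_subcategory ::
    "('k::field, 'o, 'm::ab_group_add) lincat \<Rightarrow> ('o \<Rightarrow> 'o \<Rightarrow> 'm set) \<Rightarrow> bool" where
  "wide_subcategory C H \<longleftrightarrow> (\<forall>x y. H x y \<subseteq> hom C x y) \<and> linear_category (subcat C H)"

text \<open>
  A left ideal of an endomorphism algebra, in the sense of rings, is automatically a linear subspace
  because the algebra is unital.  Semi-simple means: semi-simple as a left module over itself.
\<close>

definition left_ideal :: "('k::field, 'o, 'm::ab_group_add) lincat \<Rightarrow> 'o \<Rightarrow> 'm set \<Rightarrow> bool" where
  "left_ideal C x I \<longleftrightarrow> I \<subseteq> hom C x x \<and> module.subspace (smul C) I \<and>
     (\<forall>e\<in>hom C x x. \<forall>a\<in>I. cmp C x x x e a \<in> I)"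

definition semisimple_End :: "('k::field, 'o, 'm::ab_group_add) lincat \<Rightarrow> 'o \<Rightarrow> bool" where
  "semisimple_End C x \<longleftrightarrow>
     (\<forall>I. left_ideal C x I \<longrightarrow>
        (\<exists>J. left_ideal C x J \<and> I \<inter> J = {0} \<and> hom C x x = {a + b |a b. a \<in> I \<and> b \<in> J}))"

section \<open>Tensor products\<close>

text \<open>The type \<open>'a \<Rightarrow>\<^sub>0 'k\<close> is the free vector space on \<open>'a\<close>; this is its scalar multiplication.\<close>

definition fscale :: "'k::field \<Rightarrow> ('a \<Rightarrow>\<^sub>0 'k) \<Rightarrow> ('a \<Rightarrow>\<^sub>0 'k)" where
  "fscale c = Poly_Mapping.map ((*) c)"

text \<open>
  \<open>A\<close> is a right module (action \<open>r a e\<close>) and \<open>B\<close> a left module (action \<open>l e b\<close>) over the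
  algebra \<open>E\<close>; both are subspaces of the vector space with scalar multiplication \<open>s\<close>.
  The tensor product is the quotient of the free vector space on \<open>A \<times> B\<close> by the span of
  the relations below, realised as a set of equivalence classes.
\<close>

definition tensor_relations ::
    "('k::field \<Rightarrow> 'm \<Rightarrow> 'm) \<Rightarrow> ('m \<Rightarrow> 'm \<Rightarrow> 'm) \<Rightarrow> ('m \<Rightarrow> 'm \<Rightarrow> 'm) \<Rightarrow>
     'm::ab_group_add set \<Rightarrow> 'm set \<Rightarrow> 'm set \<Rightarrow> (('m \<times> 'm) \<Rightarrow>\<^sub>0 'k) set" where
  "tensor_relations s r l A E B =
     {Poly_Mapping.single (a + a', b) 1 - Poly_Mapping.single (a, b) 1 - Poly_Mapping.single (a', b) 1
        |a a' b. a \<in> A \<and> a' \<in> A \<and> b \<in> B} \<union>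
     {Poly_Mapping.single (a, b + b') 1 - Poly_Mapping.single (a, b) 1 - Poly_Mapping.single (a, b') 1
        |a b b'. a \<in> A \<and> b \<in> B \<and> b' \<in> B} \<union>
     {Poly_Mapping.single (s c a, b) 1 - Poly_Mapping.single (a, b) c |c a b. a \<in> A \<and> b \<in> B} \<union>
     {Poly_Mapping.single (a, s c b) 1 - Poly_Mapping.single (a, b) c |c a b. a \<in> A \<and> b \<in> B} \<union>
     {Poly_Mapping.single (r a e, b) 1 - Poly_Mapping.single (a, l e b) 1
        |a e b. a \<in> A \<and> e \<in> E \<and> b \<in> B}"

definition tensor_eq ::
    "('k::field \<Rightarrow> 'm \<Rightarrow> 'm) \<Rightarrow> ('m \<Rightarrow> 'm \<Rightarrow> 'm) \<Rightarrow> ('m \<Rightarrow> 'm \<Rightarrow> 'm) \<Rightarrow>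
     'm::ab_group_add set \<Rightarrow> 'm set \<Rightarrow> 'm set \<Rightarrow> ((('m \<times> 'm) \<Rightarrow>\<^sub>0 'k) \<times> (('m \<times> 'm) \<Rightarrow>\<^sub>0 'k)) set" where
  "tensor_eq s r l A E B =
     {(F, F'). Poly_Mapping.keys F \<subseteq> A \<times> B \<and> Poly_Mapping.keys F' \<subseteq> A \<times> B \<and>
        F - F' \<in> module.span fscale (tensor_relations s r l A E B)}"

definition tensor_product ::
    "('k::field \<Rightarrow> 'm \<Rightarrow> 'm) \<Rightarrow> ('m \<Rightarrow> 'm \<Rightarrow> 'm) \<Rightarrow> ('m \<Rightarrow> 'm \<Rightarrow> 'm) \<Rightarrow>
     'm::ab_group_add set \<Rightarrow> 'm set \<Rightarrow> 'm set \<Rightarrow> (('m \<times> 'm) \<Rightarrow>\<^sub>0 'k) set set" where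
  "tensor_product s r l A E B =
     {F. Poly_Mapping.keys F \<subseteq> A \<times> B} // tensor_eq s r l A E B"

text \<open>\<open>Hom_U(y,z) \<otimes> Hom_D(x,y)\<close> over \<open>End_U(y)\<close>, and the map to \<open>Hom_G(x,z)\<close> induced by composition.\<close>

definition UD_tensor ::
    "('k::field, 'o, 'm::ab_group_add) lincat \<Rightarrow> ('o \<Rightarrow> 'o \<Rightarrow> 'm set) \<Rightarrow> ('o \<Rightarrow> 'o \<Rightarrow> 'm set) \<Rightarrow>
     'o \<Rightarrow> 'o \<Rightarrow> 'o \<Rightarrow> (('m \<times> 'm) \<Rightarrow>\<^sub>0 'k) set set" where
  "UD_tensor G U D x z y =
     tensor_product (smul G) (cmp G y y z) (cmp G x y y) (U y z) (U y y) (D x y)"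

definition UD_zero ::
    "('k::field, 'o, 'm::ab_group_add) lincat \<Rightarrow> ('o \<Rightarrow> 'o \<Rightarrow> 'm set) \<Rightarrow> ('o \<Rightarrow> 'o \<Rightarrow> 'm set) \<Rightarrow>
     'o \<Rightarrow> 'o \<Rightarrow> 'o \<Rightarrow> (('m \<times> 'm) \<Rightarrow>\<^sub>0 'k) set" where
  "UD_zero G U D x z y =
     tensor_eq (smul G) (cmp G y y z) (cmp G x y y) (U y z) (U y y) (D x y) `` {0}"

definition free_compose ::
    "('k::field, 'o, 'm::ab_group_add) lincat \<Rightarrow> 'o \<Rightarrow> 'o \<Rightarrow> 'o \<Rightarrow> (('m \<times> 'm) \<Rightarrow>\<^sub>0 'k) \<Rightarrow> 'm" where
  "free_compose G x z y F =
     (\<Sum>(u, d)\<in>Poly_Mapping.keys F. smul G (Poly_Mapping.lookup F (u, d)) (cmp G x y z u d))"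

definition tensor_compose ::
    "('k::field, 'o, 'm::ab_group_add) lincat \<Rightarrow> 'o \<Rightarrow> 'o \<Rightarrow> 'o \<Rightarrow> (('m \<times> 'm) \<Rightarrow>\<^sub>0 'k) set \<Rightarrow> 'm" where
  "tensor_compose G x z y T = the_elem (free_compose G x z y ` T)"

text \<open>
  The direct sum over isomorphism classes; \<open>rp X\<close> is the chosen representative of the class \<open>X\<close>.
\<close>

definition UD_sum ::
    "('k::field, 'o, 'm::ab_group_add) lincat \<Rightarrow> ('o \<Rightarrow> 'o \<Rightarrow> 'm set) \<Rightarrow> ('o \<Rightarrow> 'o \<Rightarrow> 'm set) \<Rightarrow>
     ('o set \<Rightarrow> 'o) \<Rightarrow> 'o \<Rightarrow> 'o \<Rightarrow> ('o set \<Rightarrow> (('m \<times> 'm) \<Rightarrow>\<^sub>0 'k) set) set" where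
  "UD_sum G U D rp x z =
     {t \<in> (\<Pi>\<^sub>E X\<in>iso_classes G. UD_tensor G U D x z (rp X)).
        finite {X \<in> iso_classes G. t X \<noteq> UD_zero G U D x z (rp X)}}"

definition UD_map ::
    "('k::field, 'o, 'm::ab_group_add) lincat \<Rightarrow> ('o \<Rightarrow> 'o \<Rightarrow> 'm set) \<Rightarrow> ('o \<Rightarrow> 'o \<Rightarrow> 'm set) \<Rightarrow>
     ('o set \<Rightarrow> 'o) \<Rightarrow> 'o \<Rightarrow> 'o \<Rightarrow> ('o set \<Rightarrow> (('m \<times> 'm) \<Rightarrow>\<^sub>0 'k) set) \<Rightarrow> 'm" where
  "UD_map G U D rp x z t =
     (\<Sum>X\<in>{X \<in> iso_classes G. t X \<noteq> UD_zero G U D x z (rp X)}. tensor_compose G x z (rp X) (t X))"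

section \<open>Triangular categories\<close>

text \<open>\<open>(X, Y) \<in> ord\<close> stands for \<open>X \<le> Y\<close>.\<close>

definition admissible_order ::
    "('k::field, 'o, 'm::ab_group_add) lincat \<Rightarrow> ('o \<Rightarrow> 'o \<Rightarrow> 'm set) \<Rightarrow> ('o \<Rightarrow> 'o \<Rightarrow> 'm set) \<Rightarrow>
     'o set rel \<Rightarrow> bool" where
  "admissible_order G U D ord \<longleftrightarrow>
     partial_order_on (iso_classes G) ord \<and>
     (\<forall>X\<in>iso_classes G. finite {Y. (Y, X) \<in> ord}) \<and>
     (\<forall>x y. (\<exists>f\<in>U x y. f \<noteq> 0) \<longrightarrow> (iso_class G x, iso_class G y) \<in> ord) \<and>
     (\<forall>x y. (\<exists>f\<in>D x y. f \<noteq> 0) \<longrightarrow> (iso_class G y, iso_class G x) \<in> ord)"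

definition middle :: "('o \<Rightarrow> 'o \<Rightarrow> 'm set) \<Rightarrow> ('o \<Rightarrow> 'o \<Rightarrow> 'm set) \<Rightarrow> 'o \<Rightarrow> 'o \<Rightarrow> 'm set" where
  "middle U D x y = U x y \<inter> D x y"

text \<open>
  The clause on \<open>isomorphic\<close> is the convention that \<open>|G|\<close> is also the set of isomorphism classes of
  \<open>M = U \<inter> D\<close>; it is automatic when \<open>G\<close> is skeletal.  It is what makes the summands in the
  decomposition of \<open>Hom_G(x,z)\<close> independent of the representatives, makes a simple \<open>M\<close>-module supported on a full
  isomorphism class of \<open>G\<close>, and makes extending it by zero along the maps between
  non-isomorphic objects define \<open>U\<close>- and \<open>D\<close>-modules.  It does not follow from the other clauses: let \<open>G\<close>
  have objects \<open>w, x, y\<close>, an isomorphism \<open>f : x \<rightarrow> y\<close> and a further map \<open>x \<rightarrow> y\<close> factoring as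
  \<open>u d\<close> through \<open>w\<close>; if \<open>f\<close> lies in \<open>U\<close> and \<open>f + u d\<close> in \<open>D\<close>, then \<open>M\<close> need not contain any
  nonzero map \<open>x \<rightarrow> y\<close>.
\<close>

definition triangular_category ::
    "('k::field, 'o, 'm::ab_group_add) lincat \<Rightarrow> ('o \<Rightarrow> 'o \<Rightarrow> 'm set) \<Rightarrow> ('o \<Rightarrow> 'o \<Rightarrow> 'm set) \<Rightarrow> bool" where
  "triangular_category G U D \<longleftrightarrow>
     linear_category G \<and>
     wide_subcategory G U \<and> wide_subcategory G D \<and>
     (\<forall>x y. isomorphic G x y \<longrightarrow> isomorphic (subcat G (middle U D)) x y) \<and>
     (\<forall>x y. \<exists>B. finite B \<and> hom G x y \<subseteq> module.span (smul G) B) \<and>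
     (\<forall>x. U x x = D x x \<and> semisimple_End (subcat G U) x) \<and>
     (\<exists>ord. admissible_order G U D ord) \<and>
     (\<forall>rp. (\<forall>X\<in>iso_classes G. rp X \<in> X) \<longrightarrow>
        (\<forall>x z. bij_betw (UD_map G U D rp x z) (UD_sum G U D rp x z) (hom G x z)))"

section \<open>Modules\<close>

text \<open>
  \<open>Vector spaces\<close> are the subspaces of one ambient vector space \<open>('v, sV)\<close>, which plays the
  role of a universe.  Up to isomorphism these are all vector spaces of dimension at most
  \<open>dim 'v\<close>, so that \<open>'v\<close> should be thought of as infinite-dimensional; different modules, and
  different values of one module, may overlap arbitrarily inside \<open>'v\<close>.
  Restriction \<open>f\<^sup>*\<close> along the inclusion of a wide subcategory leaves the record unchanged.
\<close>

record ('o, 'm, 'v) cmod =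
  sp :: "'o \<Rightarrow> 'v set"
  act :: "'o \<Rightarrow> 'o \<Rightarrow> 'm \<Rightarrow> 'v \<Rightarrow> 'v"

definition is_module ::
    "('k::field \<Rightarrow> 'v \<Rightarrow> 'v::ab_group_add) \<Rightarrow> ('k, 'o, 'm::ab_group_add) lincat \<Rightarrow>
     ('o, 'm, 'v) cmod \<Rightarrow> bool" where
  "is_module sV C N \<longleftrightarrow>
     (\<forall>x. module.subspace sV (sp N x)) \<and>
     (\<forall>x y. \<forall>f\<in>hom C x y. \<forall>v\<in>sp N x. act N x y f v \<in> sp N y) \<and>
     (\<forall>x y. \<forall>f\<in>hom C x y. \<forall>v\<in>sp N x. \<forall>w\<in>sp N x. \<forall>a.
        act N x y f (v + w) = act N x y f v + act N x y f w \<and>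
        act N x y f (sV a v) = sV a (act N x y f v)) \<and>
     (\<forall>x y. \<forall>f\<in>hom C x y. \<forall>g\<in>hom C x y. \<forall>v\<in>sp N x. \<forall>a.
        act N x y (f + g) v = act N x y f v + act N x y g v \<and>
        act N x y (smul C a f) v = sV a (act N x y f v)) \<and>
     (\<forall>x. \<forall>v\<in>sp N x. act N x x (idt C x) v = v) \<and>
     (\<forall>x y z. \<forall>f\<in>hom C x y. \<forall>g\<in>hom C y z. \<forall>v\<in>sp N x.
        act N x z (cmp C x y z g f) v = act N y z g (act N x y f v))"

definition is_mod_hom ::
    "('k::field \<Rightarrow> 'v \<Rightarrow> 'v::ab_group_add) \<Rightarrow> ('k, 'o, 'm::ab_group_add) lincat \<Rightarrow>
     ('o, 'm, 'v) cmod \<Rightarrow> ('o, 'm, 'v) cmod \<Rightarrow> ('o \<Rightarrow> 'v \<Rightarrow> 'v) \<Rightarrow> bool" where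
  "is_mod_hom sV C N P \<phi> \<longleftrightarrow>
     (\<forall>x. \<forall>v\<in>sp N x. \<phi> x v \<in> sp P x) \<and>
     (\<forall>x. \<forall>v\<in>sp N x. \<forall>w\<in>sp N x. \<forall>a.
        \<phi> x (v + w) = \<phi> x v + \<phi> x w \<and> \<phi> x (sV a v) = sV a (\<phi> x v)) \<and>
     (\<forall>x y. \<forall>f\<in>hom C x y. \<forall>v\<in>sp N x. \<phi> y (act N x y f v) = act P x y f (\<phi> x v))"

definition mod_iso ::
    "('k::field \<Rightarrow> 'v \<Rightarrow> 'v::ab_group_add) \<Rightarrow> ('k, 'o, 'm::ab_group_add) lincat \<Rightarrow>
     ('o, 'm, 'v) cmod \<Rightarrow> ('o, 'm, 'v) cmod \<Rightarrow> bool" where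
  "mod_iso sV C N P \<longleftrightarrow>
     (\<exists>\<phi>. is_mod_hom sV C N P \<phi> \<and> (\<forall>x. bij_betw (\<phi> x) (sp N x) (sp P x)))"

definition is_submodule ::
    "('k::field \<Rightarrow> 'v \<Rightarrow> 'v::ab_group_add) \<Rightarrow> ('k, 'o, 'm::ab_group_add) lincat \<Rightarrow>
     ('o, 'm, 'v) cmod \<Rightarrow> ('o \<Rightarrow> 'v set) \<Rightarrow> bool" where
  "is_submodule sV C N K \<longleftrightarrow>
     (\<forall>x. K x \<subseteq> sp N x \<and> module.subspace sV (K x)) \<and>
     (\<forall>x y. \<forall>f\<in>hom C x y. \<forall>v\<in>K x. act N x y f v \<in> K y)"

definition submod :: "('o, 'm, 'v) cmod \<Rightarrow> ('o \<Rightarrow> 'v set) \<Rightarrow> ('o, 'm, 'v) cmod" where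
  "submod N K = N\<lparr>sp := K\<rparr>"

definition simple_module ::
    "('k::field \<Rightarrow> 'v \<Rightarrow> 'v::ab_group_add) \<Rightarrow> ('k, 'o, 'm::ab_group_add) lincat \<Rightarrow>
     ('o, 'm, 'v) cmod \<Rightarrow> bool" where
  "simple_module sV C N \<longleftrightarrow>
     is_module sV C N \<and> (\<exists>x. sp N x \<noteq> {0}) \<and>
     (\<forall>K. is_submodule sV C N K \<longrightarrow> K = (\<lambda>x. {0}) \<or> K = sp N)"

definition simple_submodule ::
    "('k::field \<Rightarrow> 'v \<Rightarrow> 'v::ab_group_add) \<Rightarrow> ('k, 'o, 'm::ab_group_add) lincat \<Rightarrow>
     ('o, 'm, 'v) cmod \<Rightarrow> ('o \<Rightarrow> 'v set) \<Rightarrow> bool" where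
  "simple_submodule sV C N K \<longleftrightarrow> is_submodule sV C N K \<and> simple_module sV C (submod N K)"

text \<open>
  Quotients are taken up to isomorphism: \<open>P\<close> is (a model of) \<open>N / K\<close> if there is a surjection
  \<open>N \<rightarrow> P\<close> with kernel \<open>K\<close>.  Complements of subspaces provide such a \<open>P\<close> inside \<open>'v\<close>.
\<close>

definition is_quotient ::
    "('k::field \<Rightarrow> 'v \<Rightarrow> 'v::ab_group_add) \<Rightarrow> ('k, 'o, 'm::ab_group_add) lincat \<Rightarrow>
     ('o, 'm, 'v) cmod \<Rightarrow> ('o \<Rightarrow> 'v set) \<Rightarrow> ('o, 'm, 'v) cmod \<Rightarrow> bool" where
  "is_quotient sV C N K P \<longleftrightarrow>
     is_module sV C P \<and>
     (\<exists>\<pi>. is_mod_hom sV C N P \<pi> \<and>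
        (\<forall>x. \<pi> x ` sp N x = sp P x \<and> {v \<in> sp N x. \<pi> x v = 0} = K x))"

definition simple_quotient ::
    "('k::field \<Rightarrow> 'v \<Rightarrow> 'v::ab_group_add) \<Rightarrow> ('k, 'o, 'm::ab_group_add) lincat \<Rightarrow>
     ('o, 'm, 'v) cmod \<Rightarrow> ('o, 'm, 'v) cmod \<Rightarrow> bool" where
  "simple_quotient sV C N Q \<longleftrightarrow>
     simple_module sV C Q \<and> (\<exists>K. is_submodule sV C N K \<and> is_quotient sV C N K Q)"

text \<open>A simple constituent is a simple module isomorphic to \<open>A / B\<close> with \<open>B \<subseteq> A\<close> submodules of \<open>N\<close>.\<close>

definition simple_constituent ::
    "('k::field \<Rightarrow> 'v \<Rightarrow> 'v::ab_group_add) \<Rightarrow> ('k, 'o, 'm::ab_group_add) lincat \<Rightarrow>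
     ('o, 'm, 'v) cmod \<Rightarrow> ('o, 'm, 'v) cmod \<Rightarrow> bool" where
  "simple_constituent sV C N Q \<longleftrightarrow>
     simple_module sV C Q \<and>
     (\<exists>A B. is_submodule sV C N A \<and> is_submodule sV C N B \<and> (\<forall>x. B x \<subseteq> A x) \<and>
        is_quotient sV C (submod N A) B Q)"

text \<open>
  For the inclusion \<open>f\<close> of a wide subcategory \<open>B\<close> into \<open>C\<close>: \<open>P\<close> is the value \<open>f\<^sub>! S\<close> of the left
  adjoint of \<open>f\<^sup>*\<close>, i.e. there is a universal arrow \<open>S \<rightarrow> f\<^sup>* P\<close>; dually \<open>P\<close> is the value
  \<open>f\<^sub>* S\<close> of the right adjoint, i.e. there is a universal arrow \<open>f\<^sup>* P \<rightarrow> S\<close>.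
\<close>

definition is_lower_shriek ::
    "('k::field \<Rightarrow> 'v \<Rightarrow> 'v::ab_group_add) \<Rightarrow> ('k, 'o, 'm::ab_group_add) lincat \<Rightarrow>
     ('k, 'o, 'm) lincat \<Rightarrow> ('o, 'm, 'v) cmod \<Rightarrow> ('o, 'm, 'v) cmod \<Rightarrow> bool" where
  "is_lower_shriek sV B C S P \<longleftrightarrow>
     is_module sV C P \<and>
     (\<exists>\<eta>. is_mod_hom sV B S P \<eta> \<and>
        (\<forall>Q \<phi>. is_module sV C Q \<and> is_mod_hom sV B S Q \<phi> \<longrightarrow>
           (\<exists>\<psi>. is_mod_hom sV C P Q \<psi> \<and> (\<forall>x. \<forall>v\<in>sp S x. \<psi> x (\<eta> x v) = \<phi> x v) \<and>
              (\<forall>\<psi>'. is_mod_hom sV C P Q \<psi>' \<and> (\<forall>x. \<forall>v\<in>sp S x. \<psi>' x (\<eta> x v) = \<phi> x v) \<longrightarrow>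
                 (\<forall>x. \<forall>v\<in>sp P x. \<psi>' x v = \<psi> x v)))))"

definition is_lower_star ::
    "('k::field \<Rightarrow> 'v \<Rightarrow> 'v::ab_group_add) \<Rightarrow> ('k, 'o, 'm::ab_group_add) lincat \<Rightarrow>
     ('k, 'o, 'm) lincat \<Rightarrow> ('o, 'm, 'v) cmod \<Rightarrow> ('o, 'm, 'v) cmod \<Rightarrow> bool" where
  "is_lower_star sV B C S P \<longleftrightarrow>
     is_module sV C P \<and>
     (\<exists>\<epsilon>. is_mod_hom sV B P S \<epsilon> \<and>
        (\<forall>Q \<phi>. is_module sV C Q \<and> is_mod_hom sV B Q S \<phi> \<longrightarrow>
           (\<exists>\<psi>. is_mod_hom sV C Q P \<psi> \<and> (\<forall>x. \<forall>v\<in>sp Q x. \<epsilon> x (\<psi> x v) = \<phi> x v) \<and>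
              (\<forall>\<psi>'. is_mod_hom sV C Q P \<psi>' \<and> (\<forall>x. \<forall>v\<in>sp Q x. \<epsilon> x (\<psi>' x v) = \<phi> x v) \<longrightarrow>
                 (\<forall>x. \<forall>v\<in>sp Q x. \<psi>' x v = \<psi> x v)))))"

section \<open>Weights, standard and costandard modules\<close>

definition weights ::
    "('k::field \<Rightarrow> 'v \<Rightarrow> 'v::ab_group_add) \<Rightarrow> ('k, 'o, 'm::ab_group_add) lincat \<Rightarrow>
     ('o \<Rightarrow> 'o \<Rightarrow> 'm set) \<Rightarrow> ('o \<Rightarrow> 'o \<Rightarrow> 'm set) \<Rightarrow> ('o, 'm, 'v) cmod set set" where
  "weights sV G U D =
     {S. simple_module sV (subcat G (middle U D)) S} //
     {(S, T). simple_module sV (subcat G (middle U D)) S \<and>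
        simple_module sV (subcat G (middle U D)) T \<and> mod_iso sV (subcat G (middle U D)) S T}"

text \<open>
  For a simple \<open>M\<close>-module, the set of objects on which it is non-zero is one isomorphism class.
\<close>

definition supp :: "('o, 'm, 'v::zero) cmod \<Rightarrow> 'o set" where
  "supp S = {x. sp S x \<noteq> {0}}"

definition extend_by_zero ::
    "('k, 'o, 'm) lincat \<Rightarrow> ('o, 'm, 'v::zero) cmod \<Rightarrow> ('o, 'm, 'v) cmod" where
  "extend_by_zero G S = S\<lparr>act := \<lambda>x y f v. if isomorphic G x y then act S x y f v else 0\<rparr>"

definition is_standard ::
    "('k::field \<Rightarrow> 'v \<Rightarrow> 'v::ab_group_add) \<Rightarrow> ('k, 'o, 'm::ab_group_add) lincat \<Rightarrow>
     ('o \<Rightarrow> 'o \<Rightarrow> 'm set) \<Rightarrow> ('o, 'm, 'v) cmod \<Rightarrow> ('o, 'm, 'v) cmod \<Rightarrow> bool" where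
  "is_standard sV G D S P \<longleftrightarrow> is_lower_shriek sV (subcat G D) G (extend_by_zero G S) P"

definition is_costandard ::
    "('k::field \<Rightarrow> 'v \<Rightarrow> 'v::ab_group_add) \<Rightarrow> ('k, 'o, 'm::ab_group_add) lincat \<Rightarrow>
     ('o \<Rightarrow> 'o \<Rightarrow> 'm set) \<Rightarrow> ('o, 'm, 'v) cmod \<Rightarrow> ('o, 'm, 'v) cmod \<Rightarrow> bool" where
  "is_costandard sV G U S P \<longleftrightarrow> is_lower_star sV (subcat G U) G (extend_by_zero G S) P"

end

theory Submission
  imports Defs
begin

text \<open>
  By (T3) every map of \<open>G\<close> is a sum of composites \<open>u d\<close> with \<open>u\<close> in \<open>U\<close> and \<open>d\<close> in \<open>D\<close>.  Hence a simple
  \<open>G\<close>-module lives above a lowest class \<open>X\<close>, its values on \<open>X\<close> form a simple \<open>M\<close>-module, and it is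
  determined by them; \<open>L \<lambda>\<close> is the one with lowest part \<open>S \<lambda>\<close>.  The universal map
  \<open>\<epsilon> : \<nabla> \<rightarrow> S \<lambda>\<close> kills no non-zero submodule.  So \<open>\<nabla>\<close> lives above \<open>X = supp \<lambda>\<close>, \<open>\<epsilon>\<close> identifies
  its values on \<open>X\<close> with \<open>S \<lambda>\<close>, and every non-zero submodule contains these values.  The smallest
  non-zero submodule is therefore simple with lowest part \<open>S \<lambda>\<close>, and the quotient by it
  vanishes on \<open>X\<close>.
\<close>

text \<open>Neither \<open>\<Delta>\<close> nor \<open>Nabla\<close> is constructed: both are given
  by universal arrows, tested against modules with values in subspaces of \<open>'v\<close>. What is
  known about them is therefore read off from the two halves of these properties. Uniqueness is
  applied to pairs of maps one of which is zero: to a quotient map and 0 for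
  \<open>\<Delta>\<close>, and to the inclusion of a submodule and 0 for \<open>Nabla\<close>.
  Existence is what excludes \<open>Nabla \<kappa> = 0\<close>: the projection of
  \<open>L \<kappa>\<close> onto its lowest part is a non-zero \<open>U\<close>-map to
  \<open>S \<kappa>\<close>, and it has to factor through \<open>Nabla \<kappa>\<close>. The
  recurring computation concerns a vector \<open>u (d v)\<close>. A non-zero \<open>d\<close> goes
  down in the order and a non-zero \<open>u\<close> goes up. So if \<open>v\<close> lives on a
  lowest class, only those \<open>d\<close> survive that stay in this class, and inside one class
  \<open>U\<close>, \<open>D\<close> and \<open>M\<close> have the same maps.\<close>

lemma subcat_simps [simp]:
  "smul (subcat C H) = smul C" "hom (subcat C H) = H"
  "idt (subcat C H) = idt C" "cmp (subcat C H) = cmp C"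
  by (simp_all add: subcat_def)

lemma submod_simps [simp]: "sp (submod N K) = K" "act (submod N K) = act N"
  by (simp_all add: submod_def)

section \<open>Consequences of the axioms of a linear category\<close>

context
  fixes C :: "('k::field, 'o, 'm::ab_group_add) lincat"
  assumes C: "linear_category C"
begin

lemma vector_space_smul: "vector_space (smul C)"
  using C by (simp add: linear_category_def)

lemma hom_subspace: "module.subspace (smul C) (hom C x y)"
  using C by (simp add: linear_category_def)

lemma zero_in_hom: "0 \<in> hom C x y"
proof -
  interpret vector_space "smul C" by (rule vector_space_smul)
  show ?thesis using hom_subspace by (rule subspace_0)
qed

lemma idt_in_hom: "idt C x \<in> hom C x x"
  using C by (simp add: linear_category_def)

lemma cmp_in_hom: "f \<in> hom C x y \<Longrightarrow> g \<in> hom C y z \<Longrightarrow> cmp C x y z g f \<in> hom C x z"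
  using C by (simp add: linear_category_def)

lemma cmp_idt: "f \<in> hom C x y \<Longrightarrow> cmp C x x y f (idt C x) = f"
    "f \<in> hom C x y \<Longrightarrow> cmp C x y y (idt C y) f = f"
  using C by (simp_all add: linear_category_def)

lemma cmp_assoc:
  "f \<in> hom C w x \<Longrightarrow> g \<in> hom C x y \<Longrightarrow> h \<in> hom C y z \<Longrightarrow>
    cmp C w y z h (cmp C w x y g f) = cmp C w x z (cmp C x y z h g) f"
  using C by (simp add: linear_category_def)

lemma cmp_add_right:
  "f \<in> hom C x y \<Longrightarrow> f' \<in> hom C x y \<Longrightarrow> g \<in> hom C y z \<Longrightarrow>
    cmp C x y z g (f + f') = cmp C x y z g f + cmp C x y z g f'"
  using C by (simp add: linear_category_def)

lemma cmp_add_left: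
  "f \<in> hom C x y \<Longrightarrow> g \<in> hom C y z \<Longrightarrow> g' \<in> hom C y z \<Longrightarrow>
    cmp C x y z (g + g') f = cmp C x y z g f + cmp C x y z g' f"
  using C by (simp add: linear_category_def)

lemma cmp_scale_right:
  "f \<in> hom C x y \<Longrightarrow> g \<in> hom C y z \<Longrightarrow> cmp C x y z g (smul C a f) = smul C a (cmp C x y z g f)"
  using C by (simp add: linear_category_def)

lemma cmp_scale_left:
  "f \<in> hom C x y \<Longrightarrow> g \<in> hom C y z \<Longrightarrow> cmp C x y z (smul C a g) f = smul C a (cmp C x y z g f)"
  using C by (simp add: linear_category_def)

end

lemma iso_class_eq_iff:
  assumes C: "linear_category C"
  shows "iso_class C x = iso_class C y \<longleftrightarrow> isomorphic C x y"
proof -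
  have refl: "isomorphic C x x" for x
    unfolding isomorphic_def using idt_in_hom[OF C] cmp_idt[OF C] by blast
  have sym: "isomorphic C y x" if "isomorphic C x y" for x y
    using that unfolding isomorphic_def by blast
  have trans: "isomorphic C x z" if xy: "isomorphic C x y" and yz: "isomorphic C y z" for x y z
  proof -
    obtain f g where f: "f \<in> hom C x y" "g \<in> hom C y x"
        "cmp C x y x g f = idt C x" "cmp C y x y f g = idt C y"
      using xy unfolding isomorphic_def by blast
    obtain f' g' where f': "f' \<in> hom C y z" "g' \<in> hom C z y"
        "cmp C y z y g' f' = idt C y" "cmp C z y z f' g' = idt C z"
      using yz unfolding isomorphic_def by blast
    \<comment> \<open>Cancelling one inverse pair in advance, in the bracketing that
      \<open>cmp_assoc\<close> produces, leaves a single inverse pair in each of the two composites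
      below.\<close>
    have "cmp C y z x (cmp C z y x g g') f' = g" "cmp C y x z (cmp C x y z f' f) g = f'"
      using f f' cmp_assoc[OF C, of f' y z g' y g x] cmp_assoc[OF C, of g y x f y f' z]
      by (simp_all add: cmp_idt[OF C])
    then have "cmp C x z x (cmp C z y x g g') (cmp C x y z f' f) = idt C x"
      "cmp C z x z (cmp C x y z f' f) (cmp C z y x g g') = idt C z"
      using f f' by (simp_all add: cmp_assoc[OF C] cmp_in_hom[OF C])
    then show ?thesis
      unfolding isomorphic_def using f f'
      by (intro bexI[of _ "cmp C x y z f' f"] bexI[of _ "cmp C z y x g g'"])
        (simp_all add: cmp_idt[OF C] cmp_in_hom[OF C])
  qed
  show ?thesis
    unfolding iso_class_def using refl sym trans by blast
qed

section \<open>Surjectivity of the triangular decomposition\<close>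

lemma lookup_fscale: "Poly_Mapping.lookup (fscale c F) k = c * Poly_Mapping.lookup F k"
  by (auto simp: fscale_def Poly_Mapping.map.rep_eq when_def)

lemma module_fscale: "module fscale"
  by unfold_locales (auto intro!: poly_mapping_eqI simp: lookup_fscale lookup_add algebra_simps)

lemma tensor_eq_class:
  assumes "Poly_Mapping.keys F \<subseteq> A \<times> B"
  shows "F \<in> tensor_eq s r l A E B `` {F}"
  using assms by (simp add: tensor_eq_def module.span_zero[OF module_fscale])

text \<open>\<open>free_compose\<close> sums over the keys of its argument, so two arguments give
  sums over different sets. Over a common finite superset they can be compared term by term; the
  added terms have coefficient 0.\<close>

lemma free_compose_superset:
  assumes "vector_space (smul G)" "finite K" "Poly_Mapping.keys F \<subseteq> K"
  shows "free_compose G x z y F =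
    (\<Sum>k\<in>K. smul G (Poly_Mapping.lookup F k) (cmp G x y z (fst k) (snd k)))"
proof -
  interpret vector_space "smul G" by fact
  show ?thesis
    unfolding free_compose_def case_prod_beta prod.collapse
    using assms by (intro sum.mono_neutral_left) (auto simp: in_keys_iff)
qed

lemma free_compose_add:
  assumes "vector_space (smul G)"
  shows "free_compose G x z y (F + F') = free_compose G x z y F + free_compose G x z y F'"
proof -
  interpret vector_space "smul G" by fact
  define K where "K = Poly_Mapping.keys F \<union> Poly_Mapping.keys F'"
  have K: "finite K" "Poly_Mapping.keys F \<subseteq> K" "Poly_Mapping.keys F' \<subseteq> K"
    "Poly_Mapping.keys (F + F') \<subseteq> K"
    using Poly_Mapping.keys_add[of F F'] by (auto simp: K_def)
  show ?thesis
    using K by (simp add: free_compose_superset[OF assms, of K] lookup_add scale_left_distrib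
        sum.distrib)
qed

lemma free_compose_fscale:
  assumes "vector_space (smul G)"
  shows "free_compose G x z y (fscale c F) = smul G c (free_compose G x z y F)"
proof -
  interpret vector_space "smul G" by fact
  have K: "Poly_Mapping.keys (fscale c F) \<subseteq> Poly_Mapping.keys F"
    by (auto simp: in_keys_iff lookup_fscale)
  show ?thesis
    using K by (simp add: free_compose_superset[OF assms, of "Poly_Mapping.keys F"]
        lookup_fscale scale_sum_right)
qed

lemma free_compose_single:
  assumes "vector_space (smul G)"
  shows "free_compose G x z y (Poly_Mapping.single (u, d) c) = smul G c (cmp G x y z u d)"
proof -
  interpret vector_space "smul G" by fact
  show ?thesis
    by (simp add: free_compose_superset[OF assms, of "{(u, d)}"])
qed

lemma free_compose_minus:
  assumes "vector_space (smul G)"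
  shows "free_compose G x z y (F - F') = free_compose G x z y F - free_compose G x z y F'"
  using free_compose_add[OF assms, of x z y "F - F'" F'] by (simp add: algebra_simps)

text \<open>Composition is bilinear, which settles the first four families of relations, and
  associative, which settles the balancing family \<open>(u e, d)\<close> against
  \<open>(u, e d)\<close>.\<close>

lemma free_compose_relation:
  assumes G: "linear_category G"
    and A: "A \<subseteq> hom G y z" and B: "B \<subseteq> hom G x y" and E: "E \<subseteq> hom G y y"
    and F: "F \<in> tensor_relations (smul G) (cmp G y y z) (cmp G x y y) A E B"
  shows "free_compose G x z y F = 0"
proof -
  have vs: "vector_space (smul G)" using G by (simp add: linear_category_def)
  interpret vector_space "smul G" by fact
  note add = cmp_add_right[OF G] cmp_add_left[OF G] cmp_scale_right[OF G] cmp_scale_left[OF G]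
  note assoc = cmp_assoc[OF G]
  show ?thesis
    using F A B E unfolding tensor_relations_def
    by (auto simp: free_compose_minus[OF vs] free_compose_single[OF vs] add assoc subset_iff)
qed

text \<open>\<open>tensor_compose\<close> is \<open>the_elem\<close> of an image, so it is
  meaningful only if composition is constant on the class. It is, because representatives differ by
  an element of the span of the relations, where \<open>free_compose\<close> vanishes.\<close>

lemma tensor_compose_class:
  assumes G: "linear_category G"
    and A: "A \<subseteq> hom G y z" and B: "B \<subseteq> hom G x y" and E: "E \<subseteq> hom G y y"
    and F: "Poly_Mapping.keys F \<subseteq> A \<times> B"
  shows "tensor_compose G x z y (tensor_eq (smul G) (cmp G y y z) (cmp G x y y) A E B `` {F}) =
    free_compose G x z y F"
proof -
  have vs: "vector_space (smul G)" using G by (simp add: linear_category_def)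
  interpret vector_space "smul G" by fact
  interpret F: module "fscale :: 'a \<Rightarrow> ('c \<times> 'c \<Rightarrow>\<^sub>0 'a) \<Rightarrow> _" by (rule module_fscale)
  let ?R = "tensor_relations (smul G) (cmp G y y z) (cmp G x y y) A E B"
  let ?T = "tensor_eq (smul G) (cmp G y y z) (cmp G x y y) A E B `` {F}"
  have ker: "free_compose G x z y H = 0" if "H \<in> F.span ?R" for H
    using that
  proof (induction rule: F.span_induct_alt)
    case base
    show ?case by (simp add: free_compose_def)
  next
    case (step c r H)
    then show ?case
      by (simp add: free_compose_add[OF vs] free_compose_fscale[OF vs]
          free_compose_relation[OF G A B E])
  qed
  have "free_compose G x z y F' = free_compose G x z y F" if "F' \<in> ?T" for F'
    using that ker[of "F - F'"] by (simp add: tensor_eq_def free_compose_minus[OF vs])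
  then have "free_compose G x z y ` ?T = {free_compose G x z y F}"
    using tensor_eq_class[OF F] by blast
  then show ?thesis by (simp add: tensor_compose_def)
qed

section \<open>Modules over a linear category\<close>

context
  fixes sV :: "'k::field \<Rightarrow> 'v::ab_group_add \<Rightarrow> 'v"
    and C :: "('k, 'o, 'm::ab_group_add) lincat" and N :: "('o, 'm, 'v) cmod"
  assumes N: "is_module sV C N"
begin

lemma sp_subspace: "module.subspace sV (sp N x)"
  using N by (simp add: is_module_def)

lemma act_closed: "f \<in> hom C x y \<Longrightarrow> v \<in> sp N x \<Longrightarrow> act N x y f v \<in> sp N y"
  using N by (simp add: is_module_def)

lemma act_add: "f \<in> hom C x y \<Longrightarrow> v \<in> sp N x \<Longrightarrow> w \<in> sp N x \<Longrightarrow>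
    act N x y f (v + w) = act N x y f v + act N x y f w"
  using N by (simp add: is_module_def)

lemma act_scale: "f \<in> hom C x y \<Longrightarrow> v \<in> sp N x \<Longrightarrow> act N x y f (sV a v) = sV a (act N x y f v)"
  using N by (auto simp: is_module_def)

lemma act_add_left: "f \<in> hom C x y \<Longrightarrow> g \<in> hom C x y \<Longrightarrow> v \<in> sp N x \<Longrightarrow>
    act N x y (f + g) v = act N x y f v + act N x y g v"
  using N by (simp add: is_module_def)

lemma act_scale_left: "f \<in> hom C x y \<Longrightarrow> v \<in> sp N x \<Longrightarrow>
    act N x y (smul C a f) v = sV a (act N x y f v)"
  using N by (auto simp: is_module_def)

lemma act_idt: "v \<in> sp N x \<Longrightarrow> act N x x (idt C x) v = v"
  using N by (simp add: is_module_def)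

lemma act_cmp: "f \<in> hom C x y \<Longrightarrow> g \<in> hom C y z \<Longrightarrow> v \<in> sp N x \<Longrightarrow>
    act N x z (cmp C x y z g f) v = act N y z g (act N x y f v)"
  using N by (simp add: is_module_def)

lemma act_zero_left: "0 \<in> hom C x y \<Longrightarrow> v \<in> sp N x \<Longrightarrow> act N x y 0 v = 0"
  using act_add_left[of 0 x y 0 v] by simp

end

lemma is_module_submod:
  assumes N: "is_module sV C N" and K: "is_submodule sV C N K"
  shows "is_module sV C (submod N K)"
proof -
  have "v \<in> sp N x" if "v \<in> K x" for v x using K that by (auto simp: is_submodule_def)
  then show ?thesis
    using K unfolding is_module_def is_submodule_def submod_simps
    by (simp add: act_add[OF N] act_scale[OF N] act_add_left[OF N] act_scale_left[OF N]
        act_idt[OF N] act_cmp[OF N])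
qed

lemma is_module_subcat:
  assumes N: "is_module sV C N" and H: "\<And>x y. H x y \<subseteq> hom C x y"
  shows "is_module sV (subcat C H) N"
  unfolding is_module_def subcat_simps
  by (simp add: sp_subspace[OF N] act_closed[OF N] act_add[OF N] act_scale[OF N]
      act_add_left[OF N] act_scale_left[OF N] act_idt[OF N] act_cmp[OF N] subsetD[OF H])

lemma is_submodule_submod:
  assumes "is_submodule sV C N K" "is_submodule sV C (submod N K) K'"
  shows "is_submodule sV C N K'"
  using assms unfolding is_submodule_def by simp blast

context
  fixes sV :: "'k::field \<Rightarrow> 'v::ab_group_add \<Rightarrow> 'v"
    and C :: "('k, 'o, 'm::ab_group_add) lincat" and N P :: "('o, 'm, 'v) cmod" and \<phi>
  assumes \<phi>: "is_mod_hom sV C N P \<phi>"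
begin

lemma mod_hom_closed: "v \<in> sp N x \<Longrightarrow> \<phi> x v \<in> sp P x"
  using \<phi> by (simp add: is_mod_hom_def)

lemma mod_hom_add: "v \<in> sp N x \<Longrightarrow> w \<in> sp N x \<Longrightarrow> \<phi> x (v + w) = \<phi> x v + \<phi> x w"
  using \<phi> by (simp add: is_mod_hom_def)

lemma mod_hom_scale: "v \<in> sp N x \<Longrightarrow> \<phi> x (sV a v) = sV a (\<phi> x v)"
  using \<phi> by (auto simp: is_mod_hom_def)

lemma mod_hom_act: "f \<in> hom C x y \<Longrightarrow> v \<in> sp N x \<Longrightarrow> \<phi> y (act N x y f v) = act P x y f (\<phi> x v)"
  using \<phi> by (simp add: is_mod_hom_def)

lemma mod_hom_zero: "0 \<in> sp N x \<Longrightarrow> \<phi> x 0 = 0"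
  using mod_hom_add[of 0 x 0] by simp

end

lemma simple_submodule_eq:
  assumes N: "simple_module sV C N" and K: "is_submodule sV C N K" and v: "v \<in> K x" "v \<noteq> 0"
  shows "K = sp N"
proof -
  have "K = (\<lambda>x. {0}) \<or> K = sp N" using N K by (simp add: simple_module_def)
  then show ?thesis using v by auto
qed

section \<open>Simple modules over a triangular category\<close>

locale triangular_modules =
  fixes G :: "('k::field, 'o, 'm::ab_group_add) lincat"
    and U D :: "'o \<Rightarrow> 'o \<Rightarrow> 'm set"
    and ord :: "'o set rel"
    and sV :: "'k \<Rightarrow> 'v::ab_group_add \<Rightarrow> 'v"
  assumes triangular: "triangular_category G U D"
    and admissible: "admissible_order G U D ord"
    and vector_space: "vector_space sV"
begin

sublocale V: vector_space sV
  by (rule vector_space)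

abbreviation cls :: "'o \<Rightarrow> 'o set" where "cls \<equiv> iso_class G"

abbreviation Mid :: "('k, 'o, 'm) lincat" where "Mid \<equiv> subcat G (middle U D)"

lemma linear_category: "linear_category G" "linear_category (subcat G U)"
    "linear_category (subcat G D)"
  using triangular by (simp_all add: triangular_category_def wide_subcategory_def)

lemma U_sub: "U x y \<subseteq> hom G x y" and D_sub: "D x y \<subseteq> hom G x y"
  using triangular by (simp_all add: triangular_category_def wide_subcategory_def)

lemma Mid_sub: "middle U D x y \<subseteq> hom G x y"
  using U_sub[of x y] by (auto simp: middle_def)

lemma U_hom: "u \<in> U x y \<Longrightarrow> u \<in> hom G x y" and D_hom: "d \<in> D x y \<Longrightarrow> d \<in> hom G x y"
    and Mid_hom: "m \<in> middle U D x y \<Longrightarrow> m \<in> hom G x y"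
  using U_sub D_sub Mid_sub by blast+

lemma zero_in: "0 \<in> U x y" "0 \<in> D x y" "0 \<in> middle U D x y" "0 \<in> hom G x y"
  using zero_in_hom[OF linear_category(1)] zero_in_hom[OF linear_category(2)]
    zero_in_hom[OF linear_category(3)] by (simp_all add: middle_def)

section \<open>The admissible order and the maps within one isomorphism class\<close>

lemma ord_refl: "(cls x, cls x) \<in> ord"
  using admissible by (auto simp: admissible_order_def partial_order_on_def preorder_on_def
      refl_on_def iso_classes_def)

lemma ord_trans: "(X, Y) \<in> ord \<Longrightarrow> (Y, Z) \<in> ord \<Longrightarrow> (X, Z) \<in> ord"
  using admissible by (auto simp: admissible_order_def partial_order_on_def preorder_on_def
      dest: transD)

lemma ord_antisym: "(X, Y) \<in> ord \<Longrightarrow> (Y, X) \<in> ord \<Longrightarrow> X = Y"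
  using admissible by (auto simp: admissible_order_def partial_order_on_def dest: antisymD)

lemma finite_below: "finite {Y. (Y, cls x) \<in> ord}"
  using admissible by (auto simp: admissible_order_def iso_classes_def)

lemma U_upwards:
  assumes "u \<in> U x y" "u \<noteq> 0"
  shows "(cls x, cls y) \<in> ord"
proof -
  have "\<forall>x y. (\<exists>f\<in>U x y. f \<noteq> 0) \<longrightarrow> (cls x, cls y) \<in> ord"
    using admissible by (simp add: admissible_order_def)
  then show ?thesis using assms by blast
qed

lemma D_downwards:
  assumes "d \<in> D x y" "d \<noteq> 0"
  shows "(cls y, cls x) \<in> ord"
proof -
  have "\<forall>x y. (\<exists>f\<in>D x y. f \<noteq> 0) \<longrightarrow> (cls y, cls x) \<in> ord"
    using admissible by (simp add: admissible_order_def)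
  then show ?thesis using assms by blast
qed

text \<open>A non-zero map lying in both \<open>U\<close> and \<open>D\<close> would make the two
  classes comparable in both directions.\<close>

lemma Mid_eq_zero: "m \<in> middle U D x y \<Longrightarrow> cls x \<noteq> cls y \<Longrightarrow> m = 0"
  using U_upwards D_downwards ord_antisym unfolding middle_def by blast

text \<open>That the isomorphism can be taken in \<open>M\<close>, and not just in \<open>G\<close>,
  is the clause on \<open>isomorphic\<close> in \<open>triangular_category\<close>.\<close>

lemma Mid_iso:
  assumes "cls x = cls y"
  obtains f g where "f \<in> middle U D x y" "g \<in> middle U D y x"
    "cmp G x y x g f = idt G x" "cmp G y x y f g = idt G y"
proof -
  have "isomorphic Mid x y"
    using assms triangular iso_class_eq_iff[OF linear_category(1)]
    by (auto simp: triangular_category_def)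
  then show ?thesis using that by (auto simp: isomorphic_def)
qed

text \<open>The axioms compare \<open>U\<close> and \<open>D\<close> on endomorphisms. An
  isomorphism \<open>f\<close> in \<open>M\<close> with inverse \<open>g\<close> turns
  \<open>h : x -> y\<close> into the endomorphism \<open>g h\<close>, and \<open>h = f (g h)\<close>
  carries membership back.\<close>

lemma U_eq_D:
  assumes "cls x = cls y"
  shows "U x y = D x y"
proof -
  obtain f g where f: "f \<in> U x y" "f \<in> D x y" and g: "g \<in> U y x" "g \<in> D y x"
    and fg: "cmp G y x y f g = idt G y"
    using Mid_iso[OF assms] unfolding middle_def by blast
  have End: "U x x = D x x"
    using triangular by (simp add: triangular_category_def)
  have factor: "cmp G x x y f (cmp G x y x g h) = h" if "h \<in> hom G x y" for h
    using that f g cmp_assoc[OF linear_category(1), of h x y g x f y]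
    by (simp add: fg U_hom cmp_idt[OF linear_category(1)])
  have "h \<in> D x y" if h: "h \<in> U x y" for h
  proof -
    have "cmp G x y x g h \<in> D x x"
      using cmp_in_hom[OF linear_category(2), of h x y g x] h g by (simp add: End)
    then show ?thesis
      using cmp_in_hom[OF linear_category(3), of "cmp G x y x g h" x x f y] f factor[of h] h
      by (simp add: U_hom)
  qed
  moreover have "h \<in> U x y" if h: "h \<in> D x y" for h
  proof -
    have "cmp G x y x g h \<in> U x x"
      using cmp_in_hom[OF linear_category(3), of h x y g x] h g by (simp add: End)
    then show ?thesis
      using cmp_in_hom[OF linear_category(2), of "cmp G x y x g h" x x f y] f factor[of h] h
      by (simp add: D_hom)
  qed
  ultimately show ?thesis by blast
qed

lemma U_Mid: "u \<in> U x y \<Longrightarrow> cls x = cls y \<Longrightarrow> u \<in> middle U D x y"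
    and D_Mid: "d \<in> D x y \<Longrightarrow> cls x = cls y \<Longrightarrow> d \<in> middle U D x y"
  using U_eq_D[of x y] by (simp_all add: middle_def)

text \<open>Surjectivity of the map in (T3), as an induction rule. There is no case for scalar
  multiples because they are absorbed into the factor \<open>u\<close>, \<open>U y z\<close> being a
  subspace.\<close>

lemma hom_induct [consumes 1, case_names zero add comp]:
  assumes g: "g \<in> hom G x z"
    and zero: "P 0"
    and add: "\<And>f f'. f \<in> hom G x z \<Longrightarrow> f' \<in> hom G x z \<Longrightarrow> P f \<Longrightarrow> P f' \<Longrightarrow> P (f + f')"
    and comp: "\<And>y u d. u \<in> U y z \<Longrightarrow> d \<in> D x y \<Longrightarrow> P (cmp G x y z u d)"
  shows "P g"
proof -
  interpret vector_space "smul G" by (rule vector_space_smul[OF linear_category(1)])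
  let ?Q = "\<lambda>f. f \<in> hom G x z \<and> P f"
  have sum: "?Q (sum h I)" if "\<And>i. i \<in> I \<Longrightarrow> ?Q (h i)" for h :: "'i \<Rightarrow> 'm" and I
    using that
  proof (induction I rule: infinite_finite_induct)
    case (insert i I)
    then show ?case
      using add subspace_add[OF hom_subspace[OF linear_category(1)]] by simp
  qed (use zero zero_in in simp_all)
  \<comment> \<open>(T3) is stated for all systems of representatives; one of them is fixed
    here.\<close>
  define rp where "rp X = (SOME x. x \<in> X)" for X :: "'o set"
  have rp: "rp X \<in> X" if "X \<in> iso_classes G" for X
    using that iso_class_eq_iff[OF linear_category(1)] unfolding rp_def iso_classes_def
    by (metis imageE iso_class_def mem_Collect_eq someI)
  then have "UD_map G U D rp x z ` UD_sum G U D rp x z = hom G x z"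
    using triangular unfolding triangular_category_def bij_betw_def by blast
  then obtain t where t: "t \<in> UD_sum G U D rp x z" and gt: "g = UD_map G U D rp x z t"
    using g by blast
  have "?Q (tensor_compose G x z (rp X) (t X))" if X: "X \<in> iso_classes G" for X
  proof -
    let ?y = "rp X"
    have "t X \<in> UD_tensor G U D x z ?y" using t X by (auto simp: UD_sum_def)
    then obtain F where F: "Poly_Mapping.keys F \<subseteq> U ?y z \<times> D x ?y" and
        tX: "t X = tensor_eq (smul G) (cmp G ?y ?y z) (cmp G x ?y ?y) (U ?y z) (U ?y ?y) (D x ?y) `` {F}"
      unfolding UD_tensor_def tensor_product_def by (auto elim!: quotientE)
    have "tensor_compose G x z ?y (t X) = free_compose G x z ?y F"
      unfolding tX by (rule tensor_compose_class[OF linear_category(1) U_sub D_sub U_sub F])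
    also have "?Q \<dots>"
      unfolding free_compose_def
    proof (rule sum)
      fix k assume "k \<in> Poly_Mapping.keys F"
      then obtain u d where k: "k = (u, d)" and u: "u \<in> U ?y z" and d: "d \<in> D x ?y"
        using F by auto
      let ?c = "Poly_Mapping.lookup F (u, d)"
      have cu: "smul G ?c u \<in> U ?y z"
        using subspace_scale[of "U ?y z" u ?c] hom_subspace[OF linear_category(2), of ?y z] u by simp
      have "smul G ?c (cmp G x ?y z u d) = cmp G x ?y z (smul G ?c u) d"
        using u d by (simp add: cmp_scale_left[OF linear_category(1)] U_hom D_hom)
      then show "?Q (case k of (u, d) \<Rightarrow> smul G (Poly_Mapping.lookup F (u, d)) (cmp G x ?y z u d))"
        using comp[OF cu d] cmp_in_hom[OF linear_category(1), OF D_hom[OF d] U_hom[OF cu]] k by simp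
    qed
    finally show ?thesis .
  qed
  then have "?Q g" unfolding gt UD_map_def by (intro sum) auto
  then show ?thesis by simp
qed

section \<open>Bounding the vectors \<open>g v\<close> by families of subspaces\<close>

lemma zero_in_sp: "is_module sV C N \<Longrightarrow> 0 \<in> sp N x"
  by (rule V.subspace_0[OF sp_subspace])

lemma act_zero_right:
  assumes "is_module sV C N" "f \<in> hom C x y"
  shows "act N x y f 0 = 0"
  using act_add[OF assms zero_in_sp zero_in_sp] assms(1) by simp

text \<open>The conclusion is membership in a subspace because \<open>g\<close> is only a sum of
  composites \<open>u d\<close>, so the property has to survive addition.\<close>

lemma act_induct:
  assumes N: "is_module sV G N" and g: "g \<in> hom G x z" and v: "v \<in> sp N x"
    and W: "V.subspace W"
    and ud: "\<And>y u d. u \<in> U y z \<Longrightarrow> d \<in> D x y \<Longrightarrow> act N y z u (act N x y d v) \<in> W"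
  shows "act N x z g v \<in> W"
  using g
proof (induction rule: hom_induct)
  case zero
  then show ?case using act_zero_left[OF N zero_in(4) v] V.subspace_0[OF W] by simp
next
  case (add f f')
  then show ?case using act_add_left[OF N _ _ v] V.subspace_add[OF W] by simp
next
  case (comp y u d)
  then show ?case using ud act_cmp[OF N D_hom U_hom v] by simp
qed

text \<open>
  The largest submodule contained in the family \<open>T\<close> of subspaces.  Applied to simple modules, it
  replaces the submodule generated by a set of vectors.
\<close>

definition core :: "('o, 'm, 'v) cmod \<Rightarrow> ('o \<Rightarrow> 'v set) \<Rightarrow> 'o \<Rightarrow> 'v set" where
  "core N T x = {v \<in> sp N x. \<forall>z. \<forall>g\<in>hom G x z. act N x z g v \<in> T z}"

lemma core_submodule:
  assumes N: "is_module sV G N" and T: "\<And>x. V.subspace (T x)"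
  shows "is_submodule sV G N (core N T)"
proof -
  have "V.subspace (core N T x)" for x
    unfolding V.subspace_def core_def
    using V.subspace_add[OF sp_subspace[OF N]] V.subspace_scale[OF sp_subspace[OF N]]
      V.subspace_add[OF T] V.subspace_scale[OF T]
    by (auto simp: zero_in_sp[OF N] act_zero_right[OF N] V.subspace_0[OF T]
        act_add[OF N] act_scale[OF N])
  moreover have "act N x y f v \<in> core N T y" if "f \<in> hom G x y" "v \<in> core N T x" for x y f v
    using that cmp_in_hom[OF linear_category(1)]
    by (auto simp: core_def act_closed[OF N] simp flip: act_cmp[OF N])
  ultimately show ?thesis by (auto simp: is_submodule_def core_def)
qed

lemma core_le:
  assumes N: "is_module sV G N"
  shows "core N T x \<subseteq> T x"
  using idt_in_hom[OF linear_category(1)] act_idt[OF N] by (fastforce simp: core_def)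

lemma simple_nonzero:
  assumes "simple_module sV C N"
  obtains x v where "v \<in> sp N x" "v \<noteq> 0"
  using assms zero_in_sp[of C N] by (auto simp: simple_module_def)

text \<open>This stands in for the fact that a non-zero \<open>v\<close> generates \<open>N\<close>:
  the core of \<open>T\<close> contains \<open>v\<close>, hence is all of \<open>N\<close>. In the
  applications \<open>T\<close> is \<open>UNIV\<close> away from the objects of interest.\<close>

lemma simple_core:
  assumes N: "simple_module sV G N" and T: "\<And>x. V.subspace (T x)"
    and v: "v \<in> sp N x" "v \<noteq> 0" and g: "\<And>z g. g \<in> hom G x z \<Longrightarrow> act N x z g v \<in> T z"
  shows "sp N z \<subseteq> T z"
proof -
  have N': "is_module sV G N" using N by (simp add: simple_module_def)
  have "v \<in> core N T x" using v g by (simp add: core_def)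
  then have "core N T = sp N"
    using simple_submodule_eq[OF N core_submodule[where T = T, OF N' T]] v(2) by blast
  then show ?thesis using core_le[OF N'] by metis
qed

section \<open>Primitive vectors, the analogues of lowest weight vectors, and lowest classes\<close>

definition primitive :: "('o, 'm, 'v) cmod \<Rightarrow> 'o \<Rightarrow> 'v \<Rightarrow> bool" where
  "primitive N x v \<longleftrightarrow> v \<in> sp N x \<and> (\<forall>y. \<forall>d\<in>D x y. cls y \<noteq> cls x \<longrightarrow> act N x y d v = 0)"

text \<open>If \<open>d\<close> leaves the class of \<open>x\<close>, then \<open>d v = 0\<close>;
  otherwise \<open>d\<close> is an \<open>M\<close>-map by \<open>D_Mid\<close>. So a primitive
  vector is first moved inside its class and then upwards.\<close>

lemma primitive_act:
  assumes N: "is_module sV G N" and v: "primitive N x v" and g: "g \<in> hom G x z"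
    and W: "V.subspace W"
    and ud: "\<And>y u d. cls y = cls x \<Longrightarrow> u \<in> U y z \<Longrightarrow> d \<in> middle U D x y \<Longrightarrow>
      act N y z u (act N x y d v) \<in> W"
  shows "act N x z g v \<in> W"
proof (rule act_induct[OF N g _ W])
  show "v \<in> sp N x" using v by (simp add: primitive_def)
  fix y u d assume u: "u \<in> U y z" and d: "d \<in> D x y"
  show "act N y z u (act N x y d v) \<in> W"
  proof (cases "cls y = cls x")
    case True
    then show ?thesis using ud u D_Mid[OF d] by simp
  next
    case False
    then show ?thesis
      using v d V.subspace_0[OF W] act_zero_right[OF N U_hom[OF u]] by (simp add: primitive_def)
  qed
qed

text \<open>If \<open>cls x\<close> is not below \<open>cls z\<close>, there is no non-zero
  \<open>U\<close>-map from the class of \<open>x\<close> to \<open>z\<close>, so every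
  \<open>g : x -> z\<close> kills \<open>v\<close>. Then \<open>v\<close> lies in the largest
  submodule vanishing at \<open>z\<close>, which is \<open>N\<close> by simplicity.\<close>

lemma primitive_above:
  assumes N: "simple_module sV G N" and v: "primitive N x v" "v \<noteq> 0" and z: "sp N z \<noteq> {0}"
  shows "(cls x, cls z) \<in> ord"
proof (rule ccontr)
  assume not: "(cls x, cls z) \<notin> ord"
  have N': "is_module sV G N" using N by (simp add: simple_module_def)
  have kill: "act N x z g v \<in> {0}" if g: "g \<in> hom G x z" for g
  proof (rule primitive_act[OF N' v(1) g])
    fix y u d assume y: "cls y = cls x" and u: "u \<in> U y z" and d: "d \<in> middle U D x y"
    have "u = 0" using U_upwards[OF u] not y by auto
    then show "act N y z u (act N x y d v) \<in> {0}"
      using act_zero_left[OF N' zero_in(4)] act_closed[OF N' Mid_hom[OF d]] v(1)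
      by (simp add: primitive_def)
  qed (rule V.subspace_single_0)
  \<comment> \<open>The condition \<open>z = z\<close> arises from the family \<open>T\<close>,
    trivial at \<open>z\<close> alone, evaluated at \<open>z\<close>.\<close>
  have "sp N z \<subseteq> (if z = z then {0} else UNIV)"
    using v kill V.subspace_single_0 V.subspace_UNIV
    by (intro simple_core[OF N, where T = "\<lambda>w. if w = z then {0} else UNIV" and v = v and x = x])
      (auto simp: primitive_def)
  then show False using z zero_in_sp[OF N'] by auto
qed

definition lowest :: "('o, 'm, 'v) cmod \<Rightarrow> 'o set \<Rightarrow> bool" where
  "lowest N X \<longleftrightarrow>
     (\<exists>x. cls x = X \<and> sp N x \<noteq> {0}) \<and> (\<forall>z. sp N z \<noteq> {0} \<longrightarrow> (X, cls z) \<in> ord)"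

text \<open>Minimising the finite number of classes below gives a minimal class of the support. Its
  vectors are primitive, since non-zero \<open>D\<close>-maps leaving the class end in zero spaces.
  Then \<open>primitive_above\<close> turns minimal into least, although \<open>ord\<close> is only
  partial.\<close>

lemma lowest_exists:
  assumes N: "simple_module sV G N"
  obtains X where "lowest N X"
proof -
  have N': "is_module sV G N" using N by (simp add: simple_module_def)
  define below where "below x = {Y. (Y, cls x) \<in> ord}" for x
  have "\<exists>x. sp N x \<noteq> {0}" using N by (simp add: simple_module_def)
  then obtain x where x: "sp N x \<noteq> {0}" and
      least: "\<And>w. sp N w \<noteq> {0} \<Longrightarrow> card (below x) \<le> card (below w)"
    using ex_has_least_nat[of "\<lambda>x. sp N x \<noteq> {0}" _ "\<lambda>x. card (below x)"] by blast
  have min: "cls w = cls x" if w: "sp N w \<noteq> {0}" "(cls w, cls x) \<in> ord" for w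
  proof -
    have "below w \<subseteq> below x" using w ord_trans by (auto simp: below_def)
    then have "below w = below x"
      using least[OF w(1)] finite_below by (intro card_seteq) (auto simp: below_def)
    then have "cls x \<in> below w" using ord_refl by (simp add: below_def)
    then show ?thesis using w(2) by (intro ord_antisym) (simp_all add: below_def)
  qed
  obtain v where v: "v \<in> sp N x" "v \<noteq> 0" using x zero_in_sp[OF N'] by blast
  have "primitive N x v"
    unfolding primitive_def
  proof (intro conjI allI ballI impI)
    fix y d assume d: "d \<in> D x y" and y: "cls y \<noteq> cls x"
    show "act N x y d v = 0"
    proof (cases "d = 0")
      case True
      then show ?thesis using act_zero_left[OF N' zero_in(4) v(1)] by simp
    next
      case False
      then have "sp N y = {0}" using D_downwards[OF d] min y by auto
      then show ?thesis using act_closed[OF N' D_hom[OF d] v(1)] by simp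
    qed
  qed (rule v(1))
  then have "lowest N (cls x)"
    using x primitive_above[OF N _ v(2)] by (auto simp: lowest_def)
  then show ?thesis by (rule that)
qed

lemma lowest_primitive:
  assumes N: "is_module sV G N" and X: "lowest N (cls x)" and v: "v \<in> sp N x"
  shows "primitive N x v"
  unfolding primitive_def
proof (intro conjI allI ballI impI)
  fix y d assume d: "d \<in> D x y" and y: "cls y \<noteq> cls x"
  show "act N x y d v = 0"
  proof (cases "d = 0")
    case True
    then show ?thesis using act_zero_left[OF N zero_in(4) v] by simp
  next
    case False
    then have "sp N y = {0}"
      using D_downwards[OF d] X y ord_antisym by (auto simp: lowest_def)
    then show ?thesis using act_closed[OF N D_hom[OF d] v] by simp
  qed
qed (rule v)

section \<open>Restriction to one isomorphism class\<close>

definition restr :: "('o, 'm, 'v) cmod \<Rightarrow> 'o set \<Rightarrow> ('o, 'm, 'v) cmod" where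
  "restr N X = submod N (\<lambda>x. if cls x = X then sp N x else {0})"

text \<open>Cutting off the values outside \<open>X\<close> is compatible with the action of
  \<open>M\<close>, because \<open>M\<close> has no non-zero maps between different classes.\<close>

lemma is_module_restr:
  assumes N: "is_module sV Mid N"
  shows "is_submodule sV Mid N (\<lambda>x. if cls x = X then sp N x else {0})"
    and "is_module sV Mid (restr N X)"
proof -
  have "act N x y f v = 0"
    if "f \<in> middle U D x y" "cls x \<noteq> cls y" "v \<in> sp N x" for x y f v
    using act_zero_left[OF N, of x y v] zero_in Mid_eq_zero[OF that(1,2)] that(3) by simp
  then show "is_submodule sV Mid N (\<lambda>x. if cls x = X then sp N x else {0})"
    using sp_subspace[OF N] V.subspace_single_0 zero_in_sp[OF N] act_zero_right[OF N]
      act_closed[OF N]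
    by (auto simp: is_submodule_def)
  then show "is_module sV Mid (restr N X)"
    unfolding restr_def by (rule is_module_submod[OF N])
qed

text \<open>Let \<open>v\<close> be a non-zero vector of an \<open>M\<close>-submodule
  \<open>K\<close> of the lowest part. It is primitive in \<open>N\<close>, so for \<open>g\<close>
  between objects of \<open>X\<close> the vector \<open>g v\<close> is a sum of vectors
  \<open>u (d v)\<close> with both factors in \<open>M\<close>, and stays in \<open>K\<close>.
  Simplicity of \<open>N\<close> then makes \<open>K\<close> everything on \<open>X\<close>.\<close>

lemma simple_restr:
  assumes N: "simple_module sV G N" and X: "lowest N X"
  shows "simple_module sV Mid (restr N X)"
proof -
  have N': "is_module sV G N" using N by (simp add: simple_module_def)
  have M: "is_module sV Mid N" using is_module_subcat[OF N' Mid_sub] .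
  have "K = sp (restr N X)"
    if K: "is_submodule sV Mid (restr N X) K" and nz: "K \<noteq> (\<lambda>x. {0})" for K
  proof -
    have sub: "V.subspace (K x)" "K x \<subseteq> (if cls x = X then sp N x else {0})" for x
      using K by (auto simp: is_submodule_def restr_def)
    have Kact: "act N x y m v \<in> K y" if "m \<in> middle U D x y" "v \<in> K x" for x y m v
      using K that by (simp add: is_submodule_def restr_def)
    obtain x v where v: "v \<in> K x" "v \<noteq> 0"
      using nz sub(1) V.subspace_0
      by (metis insertI1 subsetI subset_antisym subset_singletonD equals0D singletonI)
    have x: "cls x = X" using v sub(2)[of x] by (auto split: if_splits)
    have vN: "v \<in> sp N x" using v sub(2)[of x] x by auto
    have g: "act N x z g v \<in> K z" if g: "g \<in> hom G x z" and z: "cls z = X" for z g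
      using lowest_primitive[OF N' _ vN] X x g sub(1)
    proof (intro primitive_act[OF N' _ g])
      fix y u d assume "cls y = cls x" "u \<in> U y z" "d \<in> middle U D x y"
      then show "act N y z u (act N x y d v) \<in> K z"
        using Kact U_Mid x z v by auto
    qed simp_all
    have "sp N z \<subseteq> (if cls z = X then K z else UNIV)" for z
      by (rule simple_core[OF N, where T = "\<lambda>z. if cls z = X then K z else UNIV" and v = v and x = x])
        (use v vN g sub V.subspace_UNIV in auto)
    then have "sp N z \<subseteq> K z" if "cls z = X" for z
      using that by (metis (full_types))
    then have "K z = sp (restr N X) z" for z
      using sub(2)[of z] V.subspace_0[OF sub(1)[of z]]
      by (cases "cls z = X") (simp_all add: restr_def subset_antisym)
    then show ?thesis by blast
  qed
  then show ?thesis
    using X is_module_restr(2)[OF M] by (auto simp: simple_module_def restr_def lowest_def)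
qed

section \<open>Kernels, images, supports and extension by zero\<close>

lemma mod_hom_kernel_submodule:
  assumes N: "is_module sV C N" and P: "is_module sV C P" and \<phi>: "is_mod_hom sV C N P \<phi>"
  shows "is_submodule sV C N (\<lambda>x. {v \<in> sp N x. \<phi> x v = 0})"
  using V.subspace_add[OF sp_subspace[OF N]] V.subspace_scale[OF sp_subspace[OF N]]
  by (auto simp: is_submodule_def V.subspace_def zero_in_sp[OF N] mod_hom_zero[OF \<phi>]
      mod_hom_add[OF \<phi>] mod_hom_scale[OF \<phi>] mod_hom_act[OF \<phi>] act_closed[OF N]
      act_zero_right[OF P])

lemma mod_hom_image_submodule:
  assumes N: "is_module sV C N" and K: "is_submodule sV C N K" and \<phi>: "is_mod_hom sV C N P \<phi>"
  shows "is_submodule sV C P (\<lambda>x. \<phi> x ` K x)"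
proof -
  have K': "V.subspace (K x)" "K x \<subseteq> sp N x" for x
    using K by (auto simp: is_submodule_def)
  have "V.subspace (\<phi> x ` K x)" for x
    unfolding V.subspace_def
  proof (intro conjI ballI allI)
    show "0 \<in> \<phi> x ` K x"
      using mod_hom_zero[OF \<phi> zero_in_sp[OF N]] V.subspace_0[OF K'(1)] by (metis imageI)
    fix a b assume "a \<in> \<phi> x ` K x" "b \<in> \<phi> x ` K x"
    then show "a + b \<in> \<phi> x ` K x"
      using K'(2) V.subspace_add[OF K'(1)]
      by (auto simp: subset_iff simp flip: mod_hom_add[OF \<phi>])
  next
    fix c a assume "a \<in> \<phi> x ` K x"
    then show "sV c a \<in> \<phi> x ` K x"
      using K'(2) V.subspace_scale[OF K'(1)]
      by (auto simp: subset_iff simp flip: mod_hom_scale[OF \<phi>])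
  qed
  moreover have "act P x y f (\<phi> x v) \<in> \<phi> y ` K y" if "f \<in> hom C x y" "v \<in> K x" for x y f v
    using that K K'(2) by (auto simp: is_submodule_def subset_iff simp flip: mod_hom_act[OF \<phi>])
  ultimately show ?thesis
    using K'(2) mod_hom_closed[OF \<phi>] by (auto simp: is_submodule_def subset_iff)
qed

text \<open>Truncation to one class is an \<open>M\<close>-submodule, so only one class occurs. All
  of its objects occur because objects isomorphic in \<open>G\<close> are already isomorphic in
  \<open>M\<close>.\<close>

lemma supp_eq:
  assumes S: "simple_module sV Mid S" and x: "sp S x \<noteq> {0}"
  shows "supp S = cls x"
proof -
  have M: "is_module sV Mid S" using S by (simp add: simple_module_def)
  let ?K = "\<lambda>z. if cls z = cls x then sp S z else {0}"
  obtain v where "v \<in> ?K x" "v \<noteq> 0" using x zero_in_sp[OF M, of x] by auto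
  then have K: "?K = sp S"
    by (rule simple_submodule_eq[where K = ?K, OF S is_module_restr(1)[OF M]])
  have "cls x = cls z" if "sp S z \<noteq> {0}" for z
    using that fun_cong[OF K, of z] by (cases "cls z = cls x") simp_all
  moreover have "sp S z \<noteq> {0}" if xz: "cls x = cls z" for z
  proof -
    obtain f g where f: "f \<in> middle U D x z" and g: "g \<in> middle U D z x"
      and gf: "cmp G x z x g f = idt G x"
      using Mid_iso[OF xz] by blast
    obtain v where v: "v \<in> sp S x" "v \<noteq> 0" using x zero_in_sp[OF M] by blast
    have "act S z x g (act S x z f v) = v"
      using act_cmp[OF M, of f x z g x v] act_idt[OF M, of v x] f g gf v by simp
    then have "act S x z f v \<noteq> 0" using act_zero_right[OF M, of g z x] g v by auto
    then show ?thesis using act_closed[OF M, of f x z v] f v by auto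
  qed
  ultimately have "supp S = {z. cls x = cls z}"
    unfolding supp_def by (intro Collect_cong iffI)
  then show ?thesis
    unfolding iso_class_eq_iff[OF linear_category(1)] by (simp add: iso_class_def)
qed

lemma cls_eq_supp_iff:
  assumes S: "simple_module sV Mid S"
  shows "cls x = supp S \<longleftrightarrow> sp S x \<noteq> {0}"
proof
  assume x: "cls x = supp S"
  obtain y where "sp S y \<noteq> {0}" using S by (auto simp: simple_module_def)
  then have "cls x = cls y" using supp_eq[OF S] x by simp
  then have "x \<in> supp S"
    using x iso_class_eq_iff[OF linear_category(1), of x x] by (auto simp: iso_class_def)
  then show "sp S x \<noteq> {0}" by (simp add: supp_def)
qed (simp add: supp_eq[OF S])

text \<open>Between different classes the extension acts by 0, but there \<open>m\<close> itself is
  0.\<close>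

lemma act_extend_by_zero:
  assumes S: "is_module sV Mid S" and m: "m \<in> middle U D x y" and v: "v \<in> sp S x"
  shows "act (extend_by_zero G S) x y m v = act S x y m v"
proof (cases "cls x = cls y")
  case True
  then show ?thesis
    by (simp add: extend_by_zero_def iso_class_eq_iff[OF linear_category(1)])
next
  case False
  then show ?thesis
    using Mid_eq_zero[OF m] act_zero_left[OF S, of x y v] zero_in v
    by (auto simp: extend_by_zero_def)
qed

lemma act_extend_by_zero_diff:
  "cls x \<noteq> cls y \<Longrightarrow> act (extend_by_zero G S) x y f v = 0"
  by (simp add: extend_by_zero_def iso_class_eq_iff[OF linear_category(1)])

lemma sp_extend_by_zero [simp]: "sp (extend_by_zero G S) = sp S"
  by (simp add: extend_by_zero_def)

text \<open>The test map for the uniqueness half of the universal property in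
  \<open>costandard_socle\<close>. Its compatibility with the action amounts to the extension
  sending 0 to 0 under \<open>U\<close>-maps.\<close>

lemma zero_mod_hom_to_extension:
  assumes S: "is_module sV Mid S"
  shows "is_mod_hom sV (subcat G U) N (extend_by_zero G S) (\<lambda>x v. 0)"
proof -
  have "act (extend_by_zero G S) x y f 0 = 0" if "f \<in> U x y" for x y f
    using act_extend_by_zero[OF S U_Mid[OF that] zero_in_sp[OF S]] act_extend_by_zero_diff
      act_zero_right[OF S, of f x y] U_Mid[OF that]
    by (cases "cls x = cls y") simp_all
  then show ?thesis by (auto simp: is_mod_hom_def zero_in_sp[OF S])
qed

section \<open>Comparing simple modules through their lowest classes\<close>

text \<open>
  A simple module is determined by its restriction to its lowest class \<open>X\<close>: an isomorphism \<open>\<theta>\<close>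
  of the restrictions extends to the relation \<open>\<theta> (g v) = g w\<close> for all maps \<open>g\<close> into objects
  of \<open>X\<close>, which is the graph of an isomorphism.
\<close>

lemma simple_iso:
  assumes N: "simple_module sV G N" and P: "simple_module sV G P"
    and XN: "lowest N X" and XP: "lowest P X"
    and \<theta>: "is_mod_hom sV Mid (restr N X) (restr P X) \<theta>"
    and bij: "\<And>x. cls x = X \<Longrightarrow> bij_betw (\<theta> x) (sp N x) (sp P x)"
  shows "mod_iso sV G N P"
proof -
  have N': "is_module sV G N" and P': "is_module sV G P"
    using N P by (simp_all add: simple_module_def)
  have \<theta>_closed: "\<theta> x v \<in> sp P x" and \<theta>_scale: "\<theta> x (sV a v) = sV a (\<theta> x v)"
    if "cls x = X" "v \<in> sp N x" for x v a
    using mod_hom_closed[OF \<theta>, of v x] mod_hom_scale[OF \<theta>, of v x] that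
    by (simp_all add: restr_def)
  have \<theta>_add: "\<theta> x (v + w) = \<theta> x v + \<theta> x w" if "cls x = X" "v \<in> sp N x" "w \<in> sp N x" for x v w
    using mod_hom_add[OF \<theta>, of v x w] that by (simp add: restr_def)
  have \<theta>_act: "\<theta> y (act N x y m v) = act P x y m (\<theta> x v)"
    if "cls x = X" "m \<in> middle U D x y" "v \<in> sp N x" for x y m v
    using mod_hom_act[OF \<theta>, of m x y v] that by (simp add: restr_def)
  have \<theta>_0: "\<theta> x 0 = 0" if "cls x = X" for x
    using mod_hom_zero[OF \<theta>, of x] zero_in_sp[OF N'] that by (simp add: restr_def)
  have \<theta>_inj: "v = 0" if "cls x = X" "v \<in> sp N x" "\<theta> x v = 0" for x v
    using bij[OF that(1)] that \<theta>_0 zero_in_sp[OF N', of x] by (auto simp: bij_betw_def inj_on_def)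
  define R where "R z v w \<longleftrightarrow> v \<in> sp N z \<and> w \<in> sp P z \<and>
    (\<forall>x g. cls x = X \<longrightarrow> g \<in> hom G z x \<longrightarrow> \<theta> x (act N z x g v) = act P z x g w)" for z v w
  have R_in: "v \<in> sp N z" "w \<in> sp P z" if "R z v w" for z v w
    using that by (simp_all add: R_def)
  have R_0: "R z 0 0" for z
    by (simp add: R_def zero_in_sp[OF N'] zero_in_sp[OF P'] act_zero_right[OF N']
        act_zero_right[OF P'] \<theta>_0)
  have R_add: "R z (v + v') (w + w')" if "R z v w" "R z v' w'" for z v v' w w'
    using that V.subspace_add[OF sp_subspace[OF N']] V.subspace_add[OF sp_subspace[OF P']]
    by (simp add: R_def act_add[OF N'] act_add[OF P'] \<theta>_add act_closed[OF N'])
  have R_scale: "R z (sV a v) (sV a w)" if "R z v w" for z v w a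
    using that V.subspace_scale[OF sp_subspace[OF N']] V.subspace_scale[OF sp_subspace[OF P']]
    by (simp add: R_def act_scale[OF N'] act_scale[OF P'] \<theta>_scale act_closed[OF N'])
  have R_act: "R z' (act N z z' f v) (act P z z' f w)" if "R z v w" "f \<in> hom G z z'" for z z' f v w
    using that cmp_in_hom[OF linear_category(1)]
    by (simp add: R_def act_closed[OF N'] act_closed[OF P']
        flip: act_cmp[OF N'] act_cmp[OF P'])
  let ?T = "\<lambda>x. if cls x = X then {0} else UNIV"
  have T: "V.subspace (?T x)" for x
    using V.subspace_single_0 V.subspace_UNIV by simp
  \<comment> \<open>A vector killed by all maps into \<open>X\<close> lies in a submodule vanishing
    on \<open>X\<close>; a simple \<open>Q\<close> with lowest class \<open>X\<close> has no such
    submodule except 0.\<close>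
  have no: False if Q: "simple_module sV G Q" and XQ: "lowest Q X"
    and v: "v \<in> sp Q z" "v \<noteq> 0"
    and g: "\<And>x g. cls x = X \<Longrightarrow> g \<in> hom G z x \<Longrightarrow> act Q z x g v = 0" for Q z v
  proof -
    obtain x where "cls x = X" "sp Q x \<noteq> {0}" using XQ by (auto simp: lowest_def)
    moreover have "sp Q x \<subseteq> ?T x"
      using simple_core[where T = ?T, OF Q T v] g by auto
    ultimately show False using zero_in_sp[of G Q x] Q by (auto simp: simple_module_def)
  qed
  \<comment> \<open>Since \<open>R\<close> is closed under differences, it is single-valued and
    injective as soon as its pairs \<open>(0, w)\<close> and \<open>(v, 0)\<close> are
    trivial.\<close>
  have R_left: "w = 0" if "R z 0 w" for z w
    using no[OF P XP R_in(2)[OF that]] that by (auto simp: R_def act_zero_right[OF N'] \<theta>_0)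
  have R_right: "v = 0" if "R z v 0" for z v
    using no[OF N XN R_in(1)[OF that]] that \<theta>_inj
    by (auto simp: R_def act_zero_right[OF P'] act_closed[OF N'])
  have R_diff: "R z (v - v') (w - w')" if "R z v w" "R z v' w'" for z v v' w w'
    using R_add[OF that(1) R_scale[OF that(2), of "-1"]] by simp
  \<comment> \<open>This keeps \<open>R\<close> from being zero. A composite \<open>u d\<close>
    between objects of \<open>X\<close> either stays inside \<open>X\<close>, where
    \<open>\<theta>\<close> commutes with both factors, or \<open>d\<close> kills the primitive
    vectors on both sides.\<close>
  have R_X: "R x v (\<theta> x v)" if x: "cls x = X" and v: "v \<in> sp N x" for x v
  proof -
    have pN: "primitive N x v" and pP: "primitive P x (\<theta> x v)"
      using lowest_primitive[OF N' _ v] lowest_primitive[OF P' _ \<theta>_closed[OF x v]] x XN XP by auto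
    have "\<theta> z (act N x z g v) = act P x z g (\<theta> x v)" if z: "cls z = X" and g: "g \<in> hom G x z" for z g
      using g
    proof (induction rule: hom_induct)
      case zero
      then show ?case
        using z by (simp add: act_zero_left[OF N' zero_in(4) v] \<theta>_0
            act_zero_left[OF P' zero_in(4) \<theta>_closed[OF x v]])
    next
      case (add f f')
      then show ?case
        using z by (simp add: act_add_left[OF N' _ _ v] act_add_left[OF P' _ _ \<theta>_closed[OF x v]]
            \<theta>_add act_closed[OF N' _ v])
    next
      case (comp y u d)
      have eq: "act N x z (cmp G x y z u d) v = act N y z u (act N x y d v)"
        "act P x z (cmp G x y z u d) (\<theta> x v) = act P y z u (act P x y d (\<theta> x v))"
        using comp by (simp_all add: act_cmp[OF N' D_hom U_hom v]
            act_cmp[OF P' D_hom U_hom \<theta>_closed[OF x v]])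
      show ?case
      proof (cases "cls y = X")
        case True
        then have "d \<in> middle U D x y" "u \<in> middle U D y z"
          using comp D_Mid U_Mid x z by auto
        then show ?thesis
          unfolding eq using True x v by (simp add: \<theta>_act act_closed[OF N'] Mid_hom)
      next
        case False
        then have "act N x y d v = 0" "act P x y d (\<theta> x v) = 0"
          using pN pP comp x by (auto simp: primitive_def)
        then show ?thesis
          unfolding eq using comp z
          by (simp add: act_zero_right[OF N'] act_zero_right[OF P'] U_hom \<theta>_0)
      qed
    qed
    then show ?thesis using v \<theta>_closed[OF x v] by (simp add: R_def)
  qed
  obtain x where x: "cls x = X" "sp N x \<noteq> {0}" using XN by (auto simp: lowest_def)
  obtain v where v: "v \<in> sp N x" "v \<noteq> 0" using x zero_in_sp[OF N'] by blast
  have \<theta>v: "\<theta> x v \<noteq> 0" using \<theta>_inj x v by blast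
  \<comment> \<open>Domain and range of \<open>R\<close> are submodules, non-zero because of
    \<open>R_X\<close>, hence all of \<open>N\<close> and of \<open>P\<close> by simplicity.\<close>
  define A B where "A z = {v. \<exists>w. R z v w}" and "B z = {w. \<exists>v. R z v w}" for z
  have "V.subspace (A z)" "V.subspace (B z)" for z
    unfolding V.subspace_def A_def B_def using R_0 R_add R_scale by blast+
  moreover have "A z \<subseteq> sp N z" "B z \<subseteq> sp P z" for z
    using R_in by (auto simp: A_def B_def)
  moreover have "act N z z' f v \<in> A z'" if "f \<in> hom G z z'" "v \<in> A z" for z z' f v
    using that R_act unfolding A_def by blast
  moreover have "act P z z' f v \<in> B z'" if "f \<in> hom G z z'" "v \<in> B z" for z z' f v
    using that R_act unfolding B_def by blast
  ultimately have sub: "is_submodule sV G N A" "is_submodule sV G P B"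
    by (simp_all add: is_submodule_def)
  have "v \<in> A x" "\<theta> x v \<in> B x"
    using R_X[OF x(1) v(1)] by (auto simp: A_def B_def)
  then have dom: "A = sp N" and ran: "B = sp P"
    using simple_submodule_eq[OF N sub(1)] simple_submodule_eq[OF P sub(2)] v(2) \<theta>v by blast+
  define \<phi> where "\<phi> z v = (THE w. R z v w)" for z v
  have \<phi>_eq: "\<phi> z v = w" if "R z v w" for z v w
  proof -
    have "w' = w" if "R z v w'" for w'
      using R_left[of z "w' - w"] R_diff[OF that \<open>R z v w\<close>] by simp
    then show ?thesis unfolding \<phi>_def using that by (intro the_equality)
  qed
  have \<phi>: "R z v (\<phi> z v)" if "v \<in> sp N z" for z v
    using that \<phi>_eq unfolding dom[symmetric] A_def by blast
  have "is_mod_hom sV G N P \<phi>"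
    by (simp add: is_mod_hom_def R_in(2)[OF \<phi>] \<phi>_eq[OF R_add[OF \<phi> \<phi>]] \<phi>_eq[OF R_scale[OF \<phi>]]
        \<phi>_eq[OF R_act[OF \<phi>]])
  moreover have "inj_on (\<phi> z) (sp N z)" for z
  proof (rule inj_onI)
    fix v v' assume "v \<in> sp N z" "v' \<in> sp N z" "\<phi> z v = \<phi> z v'"
    then have "R z (v - v') 0" using R_diff[OF \<phi> \<phi>, of v z v'] by simp
    then show "v = v'" using R_right by force
  qed
  moreover have "\<phi> z ` sp N z = sp P z" for z
  proof
    show "\<phi> z ` sp N z \<subseteq> sp P z" using R_in(2)[OF \<phi>] by blast
    show "sp P z \<subseteq> \<phi> z ` sp N z"
    proof
      fix w assume "w \<in> sp P z"
      then obtain v where v: "R z v w" unfolding ran[symmetric] B_def by blast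
      then show "w \<in> \<phi> z ` sp N z" using R_in(1)[OF v] \<phi>_eq[OF v] by blast
    qed
  qed
  ultimately show ?thesis
    unfolding mod_iso_def bij_betw_def by blast
qed

text \<open>The extension by zero lets every \<open>D\<close>-map leaving its class act by 0, so the
  image of \<open>\<phi>\<close> consists of primitive vectors, and \<open>supp S\<close> is below
  everything in \<open>L\<close>. Simplicity of \<open>S\<close> gives injectivity. The image is
  stable under \<open>M\<close>, so it fills the lowest part by the same bound as in
  \<open>simple_restr\<close>.\<close>

lemma simple_head:
  assumes S: "simple_module sV Mid S" and L: "simple_module sV G L"
    and \<phi>: "is_mod_hom sV (subcat G D) (extend_by_zero G S) L \<phi>"
    and nz: "s \<in> sp S x" "\<phi> x s \<noteq> 0"
  shows "lowest L (supp S)" "is_mod_hom sV Mid S (restr L (supp S)) \<phi>"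
    "\<And>z. cls z = supp S \<Longrightarrow> bij_betw (\<phi> z) (sp S z) (sp L z)"
proof -
  have M: "is_module sV Mid S" using S by (simp add: simple_module_def)
  have L': "is_module sV G L" using L by (simp add: simple_module_def)
  have LM: "is_module sV Mid L" using is_module_subcat[OF L' Mid_sub] .
  have hom: "is_mod_hom sV Mid S L \<phi>"
    unfolding is_mod_hom_def
    using mod_hom_closed[OF \<phi>] mod_hom_act[OF \<phi>]
    by (auto simp: mod_hom_add[OF \<phi>] mod_hom_scale[OF \<phi>] middle_def
        simp flip: act_extend_by_zero[OF M])
  have S0: "0 \<in> sp S y" "\<phi> y 0 = 0" for y
    using zero_in_sp[OF M] mod_hom_zero[OF hom] by auto
  have "s \<noteq> 0" using nz S0 by auto
  then have x: "cls x = supp S" using cls_eq_supp_iff[OF S] nz by auto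
  have outside: "sp S z = {0}" if "cls z \<noteq> supp S" for z
    using cls_eq_supp_iff[OF S] that by auto
  show "is_mod_hom sV Mid S (restr L (supp S)) \<phi>"
    using hom outside S0(2) by (auto simp: is_mod_hom_def restr_def)
  have ker: "v = 0" if v: "v \<in> sp S z" "\<phi> z v = 0" for z v
  proof (rule ccontr)
    assume "v \<noteq> 0"
    then have "(\<lambda>x. {v \<in> sp S x. \<phi> x v = 0}) = sp S"
      using simple_submodule_eq[OF S mod_hom_kernel_submodule[OF M LM hom], of v z] v by blast
    then have "{v \<in> sp S x. \<phi> x v = 0} = sp S x" by (rule fun_cong)
    then show False using nz by blast
  qed
  have inj: "inj_on (\<phi> z) (sp S z)" for z
  proof (rule inj_onI)
    fix a b assume ab: "a \<in> sp S z" "b \<in> sp S z" "\<phi> z a = \<phi> z b"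
    have "a - b \<in> sp S z" using V.subspace_diff[OF sp_subspace[OF M]] ab by blast
    moreover have "\<phi> z a = \<phi> z (a - b) + \<phi> z b"
      using mod_hom_add[OF hom, of "a - b" z b] ab calculation by simp
    ultimately show "a = b" using ker[of "a - b" z] ab by simp
  qed
  have prim: "primitive L z (\<phi> z v)" if "v \<in> sp S z" for z v
    unfolding primitive_def
  proof (intro conjI allI ballI impI)
    fix y d assume d: "d \<in> D z y" and y: "cls y \<noteq> cls z"
    have "act L z y d (\<phi> z v) = \<phi> y (act (extend_by_zero G S) z y d v)"
      using mod_hom_act[OF \<phi>, of d z y v] d that by simp
    then show "act L z y d (\<phi> z v) = 0"
      using act_extend_by_zero_diff y S0 by metis
  qed (rule mod_hom_closed[OF hom that])
  have above: "(supp S, cls z) \<in> ord" if "sp L z \<noteq> {0}" for z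
    using primitive_above[OF L prim[OF nz(1)] nz(2) that] x by simp
  have "sp L x \<noteq> {0}" using mod_hom_closed[OF hom nz(1)] nz(2) by auto
  then show "lowest L (supp S)" using above x by (auto simp: lowest_def)
  have im: "is_submodule sV Mid L (\<lambda>z. \<phi> z ` sp S z)"
  proof (rule mod_hom_image_submodule[OF M _ hom])
    show "is_submodule sV Mid S (sp S)"
      using sp_subspace[OF M] act_closed[OF M] by (auto simp: is_submodule_def)
  qed
  have im_act: "act L y z m w \<in> \<phi> z ` sp S z"
    if "m \<in> middle U D y z" "w \<in> \<phi> y ` sp S y" for y z m w
    using im that unfolding is_submodule_def subcat_simps by blast
  let ?T = "\<lambda>z. if cls z = supp S then \<phi> z ` sp S z else UNIV"
  have "sp L z \<subseteq> ?T z" for z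
  proof (rule simple_core[OF L, where T = ?T and x = x and v = "\<phi> x s"])
    show "V.subspace (?T y)" for y
      using im V.subspace_UNIV by (auto simp: is_submodule_def)
    fix z g assume g: "g \<in> hom G x z"
    show "act L x z g (\<phi> x s) \<in> ?T z"
    proof (cases "cls z = supp S")
      case True
      have "act L x z g (\<phi> x s) \<in> \<phi> z ` sp S z"
      proof (rule primitive_act[OF L' prim[OF nz(1)] g])
        show "V.subspace (\<phi> z ` sp S z)" using im by (auto simp: is_submodule_def)
        fix y u d assume y: "cls y = cls x" and u: "u \<in> U y z" and d: "d \<in> middle U D x y"
        have "u \<in> middle U D y z" using U_Mid[OF u] y x True by simp
        then show "act L y z u (act L x y d (\<phi> x s)) \<in> \<phi> z ` sp S z"
          using im_act d nz(1) by blast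
      qed
      then show ?thesis using True by simp
    qed simp
  qed (use nz mod_hom_closed[OF hom] in auto)
  then show "bij_betw (\<phi> z) (sp S z) (sp L z)" if "cls z = supp S" for z
    using that inj mod_hom_closed[OF hom] by (force simp: bij_betw_def)
qed

text \<open>The map is the composite of \<open>S -> P\<close> and \<open>P -> L\<close>. If it were
  0, the quotient map and the zero map would both extend the zero map on \<open>S\<close>, and
  uniqueness would make the quotient map vanish.\<close>

lemma standard_head:
  assumes S: "simple_module sV Mid S" and P: "is_standard sV G D S P" and L: "simple_quotient sV G P L"
  obtains \<phi> where "lowest L (supp S)" "is_mod_hom sV Mid S (restr L (supp S)) \<phi>"
    "\<And>z. cls z = supp S \<Longrightarrow> bij_betw (\<phi> z) (sp S z) (sp L z)"
proof -
  obtain \<eta> where \<eta>: "is_mod_hom sV (subcat G D) (extend_by_zero G S) P \<eta>"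
    and univ: "\<And>Q \<phi>. is_module sV G Q \<Longrightarrow> is_mod_hom sV (subcat G D) (extend_by_zero G S) Q \<phi> \<Longrightarrow>
      \<exists>\<psi>. is_mod_hom sV G P Q \<psi> \<and> (\<forall>x. \<forall>v\<in>sp S x. \<psi> x (\<eta> x v) = \<phi> x v) \<and>
        (\<forall>\<psi>'. is_mod_hom sV G P Q \<psi>' \<and> (\<forall>x. \<forall>v\<in>sp S x. \<psi>' x (\<eta> x v) = \<phi> x v) \<longrightarrow>
          (\<forall>x. \<forall>v\<in>sp P x. \<psi>' x v = \<psi> x v))"
    using P unfolding is_standard_def is_lower_shriek_def sp_extend_by_zero
    by (elim conjE exE) (rule that, assumption, simp)
  have Ls: "simple_module sV G L" using L by (simp add: simple_quotient_def)
  then have L': "is_module sV G L" by (simp add: simple_module_def)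
  obtain \<pi> where \<pi>: "is_mod_hom sV G P L \<pi>" and surj: "\<And>x. \<pi> x ` sp P x = sp L x"
    using L by (auto simp: simple_quotient_def is_quotient_def)
  let ?\<phi> = "\<lambda>x v. \<pi> x (\<eta> x v)"
  have \<phi>: "is_mod_hom sV (subcat G D) (extend_by_zero G S) L ?\<phi>"
    unfolding is_mod_hom_def
    using mod_hom_closed[OF \<eta>] mod_hom_closed[OF \<pi>]
    by (auto simp: mod_hom_add[OF \<eta>] mod_hom_add[OF \<pi>] mod_hom_scale[OF \<eta>] mod_hom_scale[OF \<pi>]
        mod_hom_act[OF \<eta>] mod_hom_act[OF \<pi>] D_hom)
  have "\<exists>x. \<exists>s\<in>sp S x. ?\<phi> x s \<noteq> 0"
  proof (rule ccontr)
    assume "\<not> ?thesis"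
    then have z: "\<forall>x. \<forall>v\<in>sp S x. \<pi> x (\<eta> x v) = 0" by blast
    have zero: "is_mod_hom sV C Q L (\<lambda>x v. 0)"
      if "\<And>x y f. f \<in> hom C x y \<Longrightarrow> f \<in> hom G x y" for C and Q :: "('o, 'm, 'v) cmod"
      using that by (auto simp: is_mod_hom_def zero_in_sp[OF L'] act_zero_right[OF L'])
    have "is_mod_hom sV (subcat G D) (extend_by_zero G S) L (\<lambda>x v. 0)"
      by (rule zero) (simp add: D_hom)
    from univ[OF L' this] obtain \<psi> where
        \<psi>: "\<forall>\<psi>'. is_mod_hom sV G P L \<psi>' \<and> (\<forall>x. \<forall>v\<in>sp S x. \<psi>' x (\<eta> x v) = 0) \<longrightarrow>
          (\<forall>x. \<forall>v\<in>sp P x. \<psi>' x v = \<psi> x v)" by blast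
    have "\<pi> x v = \<psi> x v" "0 = \<psi> x v" if "v \<in> sp P x" for x v
      using \<psi>[rule_format, of \<pi>] \<psi>[rule_format, of "\<lambda>x v. 0"] \<pi> z zero[of G] that by auto
    then have "\<pi> x v = 0" if "v \<in> sp P x" for x v using that by simp
    then have "sp L x \<subseteq> {0}" for x using surj[of x] by auto
    then show False using simple_nonzero[OF Ls] by blast
  qed
  then show ?thesis using simple_head[OF S Ls \<phi>] that by blast
qed

section \<open>Costandard modules\<close>

text \<open>The vanishing of vectors is proved by the criterion labelled \<open>core\<close> in the
  proof: \<open>v = 0\<close> once \<open>\<epsilon>\<close> kills \<open>g v\<close> for every map
  \<open>g\<close>. The last conclusion passes on the existence half of the universal property and
  serves to show that \<open>P\<close> is non-zero.\<close>

lemma costandard_socle: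
  assumes S: "simple_module sV Mid S" and P: "is_costandard sV G U S P"
  obtains \<epsilon> where "is_mod_hom sV Mid P S \<epsilon>"
    "\<And>K x. is_submodule sV G P K \<Longrightarrow> K \<noteq> (\<lambda>x. {0}) \<Longrightarrow> cls x = supp S \<Longrightarrow>
      K x = sp P x \<and> bij_betw (\<epsilon> x) (sp P x) (sp S x)"
    "\<And>z. sp P z \<noteq> {0} \<Longrightarrow> (supp S, cls z) \<in> ord"
    "\<And>Q \<phi> x v. is_module sV G Q \<Longrightarrow> is_mod_hom sV (subcat G U) Q (extend_by_zero G S) \<phi> \<Longrightarrow>
      v \<in> sp Q x \<Longrightarrow> \<exists>w\<in>sp P x. \<epsilon> x w = \<phi> x v"
proof -
  obtain \<epsilon> where \<epsilon>: "is_mod_hom sV (subcat G U) P (extend_by_zero G S) \<epsilon>"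
    and univ: "\<And>Q \<phi>. is_module sV G Q \<Longrightarrow> is_mod_hom sV (subcat G U) Q (extend_by_zero G S) \<phi> \<Longrightarrow>
      \<exists>\<psi>. is_mod_hom sV G Q P \<psi> \<and> (\<forall>x. \<forall>v\<in>sp Q x. \<epsilon> x (\<psi> x v) = \<phi> x v) \<and>
        (\<forall>\<psi>'. is_mod_hom sV G Q P \<psi>' \<and> (\<forall>x. \<forall>v\<in>sp Q x. \<epsilon> x (\<psi>' x v) = \<phi> x v) \<longrightarrow>
          (\<forall>x. \<forall>v\<in>sp Q x. \<psi>' x v = \<psi> x v))"
    and P': "is_module sV G P"
    using P unfolding is_costandard_def is_lower_star_def
    by (elim conjE exE) (rule that, assumption, simp, assumption)
  have M: "is_module sV Mid S" using S by (simp add: simple_module_def)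
  have MP: "is_module sV Mid P" using is_module_subcat[OF P' Mid_sub] .
  have hom: "is_mod_hom sV Mid P S \<epsilon>"
    unfolding is_mod_hom_def
    using mod_hom_closed[OF \<epsilon>] mod_hom_act[OF \<epsilon>]
    by (auto simp: mod_hom_add[OF \<epsilon>] mod_hom_scale[OF \<epsilon>] middle_def act_extend_by_zero[OF M])
  have outside: "sp S z = {0}" if "cls z \<noteq> supp S" for z
    using cls_eq_supp_iff[OF S] that by auto
  have \<epsilon>0: "\<epsilon> x 0 = 0" for x
    by (rule mod_hom_zero[OF hom zero_in_sp[OF P']])
  have \<epsilon>U: "\<epsilon> z (act P y z u v) = act (extend_by_zero G S) y z u (\<epsilon> y v)"
    if "u \<in> U y z" "v \<in> sp P y" for y z u v
    using mod_hom_act[OF \<epsilon>, of u y z v] that by simp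
  \<comment> \<open>There are two different reasons: within its class \<open>u\<close> ends where
    \<open>S\<close> is zero, and between classes the extension acts by 0.\<close>
  have \<epsilon>U_diff: "\<epsilon> z (act P y z u v) = 0" if "u \<in> U y z" "v \<in> sp P y" "cls y \<noteq> supp S" for y z u v
  proof (cases "cls y = cls z")
    case True
    then show ?thesis
      using mod_hom_closed[OF hom act_closed[OF P' U_hom[OF that(1)] that(2)]] outside that(3) by auto
  next
    case False
    then show ?thesis using \<epsilon>U[OF that(1,2)] act_extend_by_zero_diff by simp
  qed
  have detect: "K x = {0}" if K: "is_submodule sV G P K" and z: "\<And>x v. v \<in> K x \<Longrightarrow> \<epsilon> x v = 0" for K x
  proof -
    have Q: "is_module sV G (submod P K)" by (rule is_module_submod[OF P' K])
    have sub: "K x \<subseteq> sp P x" for x using K by (simp add: is_submodule_def)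
    from univ[OF Q zero_mod_hom_to_extension[OF M]] obtain \<psi> where
        \<psi>: "\<forall>\<psi>'. is_mod_hom sV G (submod P K) P \<psi>' \<and> (\<forall>x. \<forall>v\<in>K x. \<epsilon> x (\<psi>' x v) = 0) \<longrightarrow>
          (\<forall>x. \<forall>v\<in>K x. \<psi>' x v = \<psi> x v)"
      unfolding submod_simps by blast
    \<comment> \<open>The inclusion of \<open>K\<close> and the zero map are two lifts of the zero
      map from \<open>K\<close> to \<open>S\<close>, hence equal.\<close>
    have "is_mod_hom sV G (submod P K) P (\<lambda>x v. v)"
      using sub by (auto simp: is_mod_hom_def)
    moreover have "is_mod_hom sV G (submod P K) P (\<lambda>x v. 0)"
      by (auto simp: is_mod_hom_def zero_in_sp[OF P'] act_zero_right[OF P'])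
    ultimately have "v = 0" if "v \<in> K x" for v
      using \<psi>[rule_format, of "\<lambda>x v. v"] \<psi>[rule_format, of "\<lambda>x v. 0"] z \<epsilon>0 that by simp
    then show ?thesis using zero_in_sp[OF Q, of x] by auto
  qed
  let ?T = "\<lambda>x. {v. v \<in> sp P x \<and> \<epsilon> x v = 0}"
  have T: "V.subspace (?T x)" for x
    using mod_hom_kernel_submodule[OF MP M hom] by (auto simp: is_submodule_def)
  have core: "v = 0"
    if v: "v \<in> sp P x" and g: "\<And>z g. g \<in> hom G x z \<Longrightarrow> act P x z g v \<in> ?T z" for x v
  proof -
    have "core P ?T x = {0}"
      using core_le[OF P', of ?T] by (intro detect core_submodule[where T = ?T, OF P' T]) blast
    then show ?thesis using v g by (auto simp: core_def)
  qed
  \<comment> \<open>A non-zero \<open>d\<close> from \<open>z\<close> ends in a class below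
    \<open>cls z\<close>, hence not in \<open>supp S\<close>; and \<open>\<epsilon>\<close> vanishes
    on the image of any \<open>U\<close>-map that starts outside \<open>supp S\<close>.\<close>
  have above: "(supp S, cls z) \<in> ord" if nz: "sp P z \<noteq> {0}" for z
  proof (rule ccontr)
    assume not: "(supp S, cls z) \<notin> ord"
    obtain v where v: "v \<in> sp P z" "v \<noteq> 0" using nz zero_in_sp[OF P'] by blast
    have "v = 0"
    proof (rule core[OF v(1)])
      fix z' g assume "g \<in> hom G z z'"
      then show "act P z z' g v \<in> ?T z'"
      proof (rule act_induct[OF P' _ v(1) T])
        fix y u d assume u: "u \<in> U y z'" and d: "d \<in> D z y"
        have dv: "act P z y d v \<in> sp P y" by (rule act_closed[OF P' D_hom[OF d] v(1)])
        have "act P z y d v = 0" if "cls y = supp S"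
          using D_downwards[OF d] not that act_zero_left[OF P' zero_in(4) v(1)] by auto
        then show "act P y z' u (act P z y d v) \<in> ?T z'"
          using \<epsilon>U_diff[OF u dv] act_closed[OF P' U_hom[OF u] dv] \<epsilon>0
          by (cases "cls y = supp S") (auto simp: act_zero_right[OF P' U_hom[OF u]])
      qed
    qed
    then show False using v by simp
  qed
  \<comment> \<open>If \<open>d\<close> stays in \<open>supp S\<close>, then \<open>d v\<close> is
    again killed by \<open>\<epsilon>\<close>, which is an \<open>M\<close>-map, and so is
    \<open>u (d v)\<close>. If \<open>d\<close> leaves \<open>supp S\<close>, then
    \<open>\<epsilon>U_diff\<close> applies.\<close>
  have inj0: "v = 0" if x: "cls x = supp S" and v: "v \<in> sp P x" "\<epsilon> x v = 0" for x v
  proof (rule core[OF v(1)])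
    fix z g assume "g \<in> hom G x z"
    then show "act P x z g v \<in> ?T z"
    proof (rule act_induct[OF P' _ v(1) T])
      fix y u d assume u: "u \<in> U y z" and d: "d \<in> D x y"
      have dv: "act P x y d v \<in> sp P y" by (rule act_closed[OF P' D_hom[OF d] v(1)])
      have "\<epsilon> z (act P y z u (act P x y d v)) = 0"
      proof (cases "cls y = supp S")
        case True
        then have d': "d \<in> middle U D x y" using D_Mid[OF d] x by simp
        have dv0: "\<epsilon> y (act P x y d v) = 0"
          using mod_hom_act[OF hom, of d x y v] act_zero_right[OF M, of d x y] d' v by simp
        show ?thesis
        proof (cases "cls y = cls z")
          case True
          then have u': "u \<in> middle U D y z" using U_Mid[OF u] by simp
          then show ?thesis
            using mod_hom_act[OF hom, of u y z "act P x y d v"] act_zero_right[OF M, of u y z] dv dv0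
            by simp
        next
          case False
          then show ?thesis using \<epsilon>U[OF u dv] act_extend_by_zero_diff by simp
        qed
      next
        case False
        then show ?thesis by (rule \<epsilon>U_diff[OF u dv])
      qed
      then show "act P y z u (act P x y d v) \<in> ?T z"
        using act_closed[OF P' U_hom[OF u] dv] by simp
    qed
  qed
  have inj: "inj_on (\<epsilon> x) (sp P x)" if x: "cls x = supp S" for x
  proof (rule inj_onI)
    fix a b assume ab: "a \<in> sp P x" "b \<in> sp P x" "\<epsilon> x a = \<epsilon> x b"
    have "a - b \<in> sp P x" using V.subspace_diff[OF sp_subspace[OF P']] ab by blast
    moreover have "\<epsilon> x a = \<epsilon> x (a - b) + \<epsilon> x b"
      using mod_hom_add[OF hom, of "a - b" x b] ab calculation by simp
    ultimately show "a = b" using inj0[OF x, of "a - b"] ab by simp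
  qed
  have full: "K x = sp P x \<and> bij_betw (\<epsilon> x) (sp P x) (sp S x)"
    if K: "is_submodule sV G P K" and nz: "K \<noteq> (\<lambda>x. {0})" and x: "cls x = supp S" for K x
  proof -
    have sub: "K x \<subseteq> sp P x" using K by (simp add: is_submodule_def)
    have KM: "is_submodule sV Mid P K"
      using K Mid_hom by (auto simp: is_submodule_def)
    \<comment> \<open>By \<open>detect\<close> the image of \<open>K\<close> under
      \<open>\<epsilon>\<close> is a non-zero \<open>M\<close>-submodule of the simple module
      \<open>S\<close>, hence \<open>S\<close>. Injectivity on \<open>supp S\<close> then leaves no
      room between \<open>K x\<close> and \<open>sp P x\<close>.\<close>
    have "\<exists>x v. v \<in> K x \<and> \<epsilon> x v \<noteq> 0" using detect[OF K] nz by blast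
    then have "(\<lambda>x. \<epsilon> x ` K x) = sp S"
      using simple_submodule_eq[OF S mod_hom_image_submodule[OF MP KM hom]] by blast
    then have im: "\<epsilon> x ` K x = sp S x" by metis
    then have im': "\<epsilon> x ` sp P x = \<epsilon> x ` K x" using sub mod_hom_closed[OF hom] by blast
    then show ?thesis
      using inj_on_image_eq_iff[OF inj[OF x] sub order_refl] inj[OF x] im by (auto simp: bij_betw_def)
  qed
  have lift: "\<exists>w\<in>sp P x. \<epsilon> x w = \<phi> x v"
    if Q: "is_module sV G Q" and \<phi>: "is_mod_hom sV (subcat G U) Q (extend_by_zero G S) \<phi>"
      and v: "v \<in> sp Q x" for Q \<phi> x v
  proof -
    from univ[OF Q \<phi>] obtain \<psi> where \<psi>: "is_mod_hom sV G Q P \<psi>"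
        "\<And>x v. v \<in> sp Q x \<Longrightarrow> \<epsilon> x (\<psi> x v) = \<phi> x v" by blast
    then show ?thesis using mod_hom_closed[OF \<psi>(1) v] v by blast
  qed
  show ?thesis
    by (rule that[OF hom]) (fact full, fact above, fact lift)
qed

text \<open>Inverting \<open>\<phi>\<close> on the lowest class and sending the rest to 0 commutes
  with \<open>U\<close>: a non-zero \<open>U\<close>-map entering the lowest class from another
  class starts strictly below it, where \<open>L\<close> is zero, and one leaving it acts by 0 on
  the extension.\<close>

lemma lowest_projection:
  assumes S: "simple_module sV Mid S" and L: "is_module sV G L" and low: "lowest L (supp S)"
    and \<phi>: "is_mod_hom sV Mid S (restr L (supp S)) \<phi>"
    and bij: "\<And>z. cls z = supp S \<Longrightarrow> bij_betw (\<phi> z) (sp S z) (sp L z)"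
  shows "is_mod_hom sV (subcat G U) L (extend_by_zero G S)
    (\<lambda>x v. if cls x = supp S then inv_into (sp S x) (\<phi> x) v else 0)"
proof -
  have M: "is_module sV Mid S" using S by (simp add: simple_module_def)
  let ?p = "\<lambda>x v. if cls x = supp S then inv_into (sp S x) (\<phi> x) v else 0"
  have p: "?p x v \<in> sp S x" "\<phi> x (?p x v) = v" if "cls x = supp S" "v \<in> sp L x" for x v
    using bij[OF that(1)] that
    by (simp_all add: bij_betw_def inv_into_into f_inv_into_f)
  have p_eq: "?p x v = s" if "cls x = supp S" "s \<in> sp S x" "\<phi> x s = v" for x v s
    using bij[OF that(1)] that by (auto simp: bij_betw_def)
  have "?p x v \<in> sp S x" if "v \<in> sp L x" for x v
    using p(1)[OF _ that] zero_in_sp[OF M] by simp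
  moreover have "?p x (v + w) = ?p x v + ?p x w" if "v \<in> sp L x" "w \<in> sp L x" for x v w
  proof (cases "cls x = supp S")
    case True
    show ?thesis
      by (rule p_eq[OF True]) (use p[OF True] that V.subspace_add[OF sp_subspace[OF M]] True in
          \<open>simp_all add: mod_hom_add[OF \<phi>]\<close>)
  qed simp
  moreover have "?p x (sV a v) = sV a (?p x v)" if "v \<in> sp L x" for x v a
  proof (cases "cls x = supp S")
    case True
    show ?thesis
      by (rule p_eq[OF True]) (use p[OF True] that V.subspace_scale[OF sp_subspace[OF M]] True in
          \<open>simp_all add: mod_hom_scale[OF \<phi>]\<close>)
  qed simp
  moreover have "?p y (act L x y u v) = act (extend_by_zero G S) x y u (?p x v)"
    if u: "u \<in> U x y" and v: "v \<in> sp L x" for x y u v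
  proof (cases "cls x = cls y")
    case True
    then have m: "u \<in> middle U D x y" using U_Mid[OF u] by simp
    have ext: "act (extend_by_zero G S) x y u s = act S x y u s" if "s \<in> sp S x" for s
      using act_extend_by_zero[OF M m that] .
    show ?thesis
    proof (cases "cls x = supp S")
      case x: True
      then have y: "cls y = supp S" using True by simp
      have "?p y (act L x y u v) = act S x y u (?p x v)"
      proof (rule p_eq[OF y])
        show "act S x y u (?p x v) \<in> sp S y" using act_closed[OF M, of u x y] m p(1)[OF x v] by simp
        show "\<phi> y (act S x y u (?p x v)) = act L x y u v"
          using mod_hom_act[OF \<phi>, of u x y "?p x v"] m p[OF x v] by (simp add: restr_def)
      qed
      then show ?thesis using ext[OF p(1)[OF x v]] by simp
    next
      case False
      then show ?thesis
        using True ext[OF zero_in_sp[OF M]] act_zero_right[OF M, of u x y] m by simp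
    qed
  next
    case False
    have "act L x y u v = 0" if y: "cls y = supp S"
    proof (cases "u = 0")
      case True
      then show ?thesis using act_zero_left[OF L zero_in(4) v] by simp
    next
      case nz: False
      have "sp L x = {0}"
      proof (rule ccontr)
        assume "sp L x \<noteq> {0}"
        then have "(cls y, cls x) \<in> ord" using low y by (simp add: lowest_def)
        then show False using ord_antisym[OF U_upwards[OF u nz]] False by blast
      qed
      then show ?thesis using v act_zero_right[OF L U_hom[OF u]] by simp
    qed
    moreover have "?p y 0 = 0"
      using p_eq[OF _ zero_in_sp[OF M] mod_hom_zero[OF \<phi> zero_in_sp[OF M]]] by simp
    ultimately show ?thesis using act_extend_by_zero_diff[OF False] by (cases "cls y = supp S") auto
  qed
  ultimately show ?thesis by (simp add: is_mod_hom_def)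
qed

section \<open>Classification of simple modules by weights\<close>

lemma weight_simple: "\<mu> \<in> weights sV G U D \<Longrightarrow> T \<in> \<mu> \<Longrightarrow> simple_module sV Mid T"
  by (auto simp: weights_def elim!: quotientE)

lemma supp_mod_iso:
  assumes "is_module sV Mid T" "is_module sV Mid T'" "mod_iso sV Mid T T'"
  shows "supp T = supp T'"
proof -
  obtain \<phi> where \<phi>: "is_mod_hom sV Mid T T' \<phi>" and bij: "\<And>x. bij_betw (\<phi> x) (sp T x) (sp T' x)"
    using assms(3) by (auto simp: mod_iso_def)
  have "sp T x = {0} \<longleftrightarrow> sp T' x = {0}" for x
  proof
    assume "sp T x = {0}"
    then show "sp T' x = {0}"
      using bij_betw_imp_surj_on[OF bij[of x]] mod_hom_zero[OF \<phi> zero_in_sp[OF assms(1)]] by simp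
  next
    assume *: "sp T' x = {0}"
    have "v = 0" if "v \<in> sp T x" for v
      using inj_onD[OF bij_betw_imp_inj_on[OF bij[of x]], of v 0] that *
        mod_hom_closed[OF \<phi> that] mod_hom_closed[OF \<phi> zero_in_sp[OF assms(1), of x]]
        zero_in_sp[OF assms(1), of x] by simp
    then show "sp T x = {0}" using zero_in_sp[OF assms(1)] by blast
  qed
  then show ?thesis by (simp add: supp_def)
qed

text \<open>The lowest part of \<open>Q\<close> is a simple \<open>M\<close>-module, and its
  isomorphism class is the weight \<open>\<mu>\<close>. By \<open>standard_head\<close> the lowest
  part of \<open>L \<mu>\<close> is \<open>S \<mu>\<close>, so \<open>simple_iso\<close> applies
  once the lowest part of \<open>Q\<close> is identified with the chosen representative
  \<open>S \<mu>\<close>.\<close>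

lemma simple_classification:
  assumes S: "\<forall>\<mu>\<in>weights sV G U D. S \<mu> \<in> \<mu>"
    and \<Delta>: "\<forall>\<mu>\<in>weights sV G U D. is_standard sV G D (S \<mu>) (\<Delta> \<mu>)"
    and L: "\<forall>\<mu>\<in>weights sV G U D. simple_quotient sV G (\<Delta> \<mu>) (L \<mu>)"
    and Q: "simple_module sV G Q" and X: "lowest Q X"
  shows "\<exists>\<mu>\<in>weights sV G U D. mod_iso sV G Q (L \<mu>) \<and> supp (S \<mu>) = X"
proof -
  define T where "T = restr Q X"
  have T: "simple_module sV Mid T" unfolding T_def by (rule simple_restr[OF Q X])
  define \<mu> where "\<mu> = {T'. simple_module sV Mid T' \<and> mod_iso sV Mid T T'}"
  have \<mu>: "\<mu> \<in> weights sV G U D"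
    unfolding weights_def \<mu>_def using T by (auto simp: quotient_def)
  then have Ss: "simple_module sV Mid (S \<mu>)" and iso: "mod_iso sV Mid T (S \<mu>)"
    using S by (auto simp: \<mu>_def)
  obtain x where x: "cls x = X" "sp Q x \<noteq> {0}" using X by (auto simp: lowest_def)
  then have "supp T = X" using supp_eq[OF T, of x] by (simp add: T_def restr_def)
  then have supp: "supp (S \<mu>) = X"
    using supp_mod_iso[OF _ _ iso] T Ss by (simp add: simple_module_def)
  obtain \<phi> where \<phi>: "lowest (L \<mu>) X" "is_mod_hom sV Mid (S \<mu>) (restr (L \<mu>) X) \<phi>"
    "\<And>z. cls z = X \<Longrightarrow> bij_betw (\<phi> z) (sp (S \<mu>) z) (sp (L \<mu>) z)"
    using standard_head[OF Ss] \<Delta> L \<mu> supp by metis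
  obtain \<tau> where \<tau>: "is_mod_hom sV Mid T (S \<mu>) \<tau>" and bij: "\<And>x. bij_betw (\<tau> x) (sp T x) (sp (S \<mu>) x)"
    using iso by (auto simp: mod_iso_def)
  have "is_mod_hom sV Mid (restr Q X) (restr (L \<mu>) X) (\<lambda>x. \<phi> x \<circ> \<tau> x)"
    unfolding is_mod_hom_def T_def[symmetric]
    using mod_hom_closed[OF \<tau>] mod_hom_closed[OF \<phi>(2)]
    by (auto simp: mod_hom_add[OF \<tau>] mod_hom_add[OF \<phi>(2)] mod_hom_scale[OF \<tau>]
        mod_hom_scale[OF \<phi>(2)] mod_hom_act[OF \<tau>] mod_hom_act[OF \<phi>(2)])
  moreover have "bij_betw (\<phi> x \<circ> \<tau> x) (sp Q x) (sp (L \<mu>) x)" if "cls x = X" for x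
    using bij_betw_trans[OF bij[of x] \<phi>(3)[OF that]] that by (simp add: T_def restr_def)
  moreover have "simple_module sV G (L \<mu>)" using L \<mu> by (simp add: simple_quotient_def)
  ultimately have "mod_iso sV G Q (L \<mu>)" using simple_iso[OF Q _ X \<phi>(1)] by blast
  then show ?thesis using \<mu> supp by blast
qed

end

section \<open>Socle and remaining constituents of the costandard module\<close>

theorem proposition4p14:
  fixes G :: "('k::alg_closed_field, 'o, 'm::ab_group_add) lincat"
    and U D :: "'o \<Rightarrow> 'o \<Rightarrow> 'm set"
    and ord :: "'o set rel"
    and sV :: "'k \<Rightarrow> 'v::ab_group_add \<Rightarrow> 'v"
    and S \<Delta> L Nabla :: "('o, 'm, 'v) cmod set \<Rightarrow> ('o, 'm, 'v) cmod"
    and \<kappa> :: "('o, 'm, 'v) cmod set"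
  assumes "triangular_category G U D"
    and "admissible_order G U D ord"
    and "vector_space sV"
    and "\<forall>\<mu>\<in>weights sV G U D. S \<mu> \<in> \<mu>"
    and "\<forall>\<mu>\<in>weights sV G U D. is_standard sV G D (S \<mu>) (\<Delta> \<mu>)"
    and "\<forall>\<mu>\<in>weights sV G U D. simple_quotient sV G (\<Delta> \<mu>) (L \<mu>)"
    and "\<forall>\<mu>\<in>weights sV G U D. is_costandard sV G U (S \<mu>) (Nabla \<mu>)"
    and "\<kappa> \<in> weights sV G U D"
  shows "(\<exists>!K. simple_submodule sV G (Nabla \<kappa>) K) \<and>
         (\<forall>K. simple_submodule sV G (Nabla \<kappa>) K \<longrightarrow>
            mod_iso sV G (submod (Nabla \<kappa>) K) (L \<kappa>) \<and>
            (\<forall>P Q. is_quotient sV G (Nabla \<kappa>) K P \<and> simple_constituent sV G P Q \<longrightarrow>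
               (\<exists>\<mu>\<in>weights sV G U D. mod_iso sV G Q (L \<mu>) \<and>
                  (supp (S \<kappa>), supp (S \<mu>)) \<in> ord \<and> supp (S \<kappa>) \<noteq> supp (S \<mu>))))"
proof -
  interpret triangular_modules G U D ord sV
    using assms(1-3) by (rule triangular_modules.intro)
  define X where "X = supp (S \<kappa>)"
  let ?N = "Nabla \<kappa>"
  have S: "simple_module sV Mid (S \<kappa>)"
    by (rule weight_simple[OF assms(8) bspec[OF assms(4,8)]])
  have L: "simple_module sV G (L \<kappa>)"
    using assms(6,8) by (simp add: simple_quotient_def)
  then have L': "is_module sV G (L \<kappa>)" by (simp add: simple_module_def)
  have costd: "is_costandard sV G U (S \<kappa>) ?N" using assms(7,8) by blast
  then have N: "is_module sV G ?N" by (simp add: is_costandard_def is_lower_star_def)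
  obtain \<epsilon> where \<epsilon>: "is_mod_hom sV Mid ?N (S \<kappa>) \<epsilon>"
    and full: "\<And>K x. is_submodule sV G ?N K \<Longrightarrow> K \<noteq> (\<lambda>x. {0}) \<Longrightarrow> cls x = X \<Longrightarrow>
      K x = sp ?N x \<and> bij_betw (\<epsilon> x) (sp ?N x) (sp (S \<kappa>) x)"
    and above: "\<And>z. sp ?N z \<noteq> {0} \<Longrightarrow> (X, cls z) \<in> ord"
    and lift: "\<And>Q \<phi> x v. is_module sV G Q \<Longrightarrow>
      is_mod_hom sV (subcat G U) Q (extend_by_zero G (S \<kappa>)) \<phi> \<Longrightarrow>
      v \<in> sp Q x \<Longrightarrow> \<exists>w\<in>sp ?N x. \<epsilon> x w = \<phi> x v"
    by (rule costandard_socle[OF S costd, folded X_def]) (rule that)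
  obtain \<phi> where low: "lowest (L \<kappa>) X"
    and \<phi>: "is_mod_hom sV Mid (S \<kappa>) (restr (L \<kappa>) X) \<phi>"
    and bij: "\<And>z. cls z = X \<Longrightarrow> bij_betw (\<phi> z) (sp (S \<kappa>) z) (sp (L \<kappa>) z)"
    by (rule standard_head[OF S bspec[OF assms(5,8)] bspec[OF assms(6,8)], folded X_def]) (rule that)
  obtain x where x: "cls x = X" "sp (L \<kappa>) x \<noteq> {0}"
    using low by (auto simp: lowest_def)
  obtain s where s: "s \<in> sp (S \<kappa>) x" "s \<noteq> 0"
    using cls_eq_supp_iff[OF S, of x] x(1) zero_in_sp[of Mid "S \<kappa>" x] S
    by (auto simp: X_def simple_module_def)
  \<comment> \<open>The costandard module is non-zero because \<open>L \<kappa>\<close> maps to it: the projection of \<open>L \<kappa>\<close> onto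
    its lowest part is a map of \<open>U\<close>-modules.\<close>
  have "\<exists>w\<in>sp ?N x. \<epsilon> x w = s"
    using lift[OF L' lowest_projection[OF S L' _ \<phi>[unfolded X_def]], of "\<phi> x s" x] low bij x(1) s(1)
      mod_hom_closed[OF \<phi>, of s x]
    by (simp add: X_def restr_def bij_betw_def)
  then obtain w where w: "w \<in> sp ?N x" "w \<noteq> 0"
    using s(2) mod_hom_zero[OF \<epsilon> zero_in_sp[OF N]] by blast
  have w_in: "w \<in> K x" if "is_submodule sV G ?N K" "K \<noteq> (\<lambda>x. {0})" for K
    using full[OF that x(1)] w(1) by blast
  \<comment> \<open>The submodule generated by \<open>w\<close>, written as an intersection. Every
    non-zero submodule contains \<open>w\<close>, so this is the least of them.\<close>
  define K0 where "K0 z = {v \<in> sp ?N z. \<forall>K. is_submodule sV G ?N K \<and> w \<in> K x \<longrightarrow> v \<in> K z}" for z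
  have "V.subspace (K0 z)" for z
    unfolding V.subspace_def K0_def
    using V.subspace_add[OF sp_subspace[OF N]] V.subspace_scale[OF sp_subspace[OF N]]
      V.subspace_add V.subspace_scale V.subspace_0
    by (auto simp: zero_in_sp[OF N] is_submodule_def)
  then have K0: "is_submodule sV G ?N K0"
    by (auto simp: is_submodule_def K0_def act_closed[OF N])
  have w0: "w \<in> K0 x" using w(1) by (simp add: K0_def)
  have K0_le: "K0 z \<subseteq> K z" if "is_submodule sV G ?N K" "K \<noteq> (\<lambda>x. {0})" for K z
    using that w_in by (auto simp: K0_def)
  have "K = K0" if K: "is_submodule sV G (submod ?N K0) K" "K \<noteq> (\<lambda>x. {0})" for K
    using K0_le[OF is_submodule_submod[OF K0 K(1)] K(2)] K(1)
    by (intro ext) (simp add: is_submodule_def subset_antisym)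
  then have simple: "simple_submodule sV G ?N K0"
    using K0 w0 w(2) is_module_submod[OF N K0]
    unfolding simple_submodule_def simple_module_def by auto
  have unique: "K = K0" if K: "simple_submodule sV G ?N K" for K
  proof -
    have K': "is_submodule sV G ?N K" "simple_module sV G (submod ?N K)"
      using K by (auto simp: simple_submodule_def)
    have "K \<noteq> (\<lambda>x. {0})" using simple_nonzero[OF K'(2)] by fastforce
    then have "is_submodule sV G (submod ?N K) K0"
      using K0_le[OF K'(1)] K0 by (simp add: is_submodule_def)
    then show ?thesis using simple_submodule_eq[where K = K0 and x = x, OF K'(2) _ w0 w(2)] by simp
  qed
  have K0_full: "K0 z = sp ?N z" "bij_betw (\<epsilon> z) (sp ?N z) (sp (S \<kappa>) z)" if "cls z = X" for z
    using full[OF K0 _ that] w0 w(2) by auto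
  have simple': "simple_module sV G (submod ?N K0)"
    using simple by (simp add: simple_submodule_def)
  have "lowest (submod ?N K0) X"
    unfolding lowest_def submod_simps
  proof (intro conjI allI impI exI[of _ x])
    show "K0 x \<noteq> {0}" using w0 w(2) by auto
    fix z assume "K0 z \<noteq> {0}"
    then show "(X, cls z) \<in> ord"
      using above[of z] K0 V.subspace_0[of "K0 z"] by (auto simp: is_submodule_def)
  qed (rule x(1))
  \<comment> \<open>The lowest parts are matched through \<open>S \<kappa>\<close>, by
    \<open>\<epsilon>\<close> into it and by \<open>\<phi>\<close> out of it.\<close>
  moreover have "is_mod_hom sV Mid (restr (submod ?N K0) X) (restr (L \<kappa>) X) (\<lambda>z. \<phi> z \<circ> \<epsilon> z)"
  proof -
    have "v \<in> sp ?N z" if "v \<in> sp (restr (submod ?N K0) X) z" for v z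
      using that zero_in_sp[OF N] K0 by (auto simp: restr_def is_submodule_def split: if_splits)
    then show ?thesis
      unfolding is_mod_hom_def
      using mod_hom_closed[OF \<epsilon>] mod_hom_closed[OF \<phi>]
      by (simp add: mod_hom_add[OF \<epsilon>] mod_hom_add[OF \<phi>] mod_hom_scale[OF \<epsilon>] mod_hom_scale[OF \<phi>]
          mod_hom_act[OF \<phi>, symmetric] mod_hom_act[OF \<epsilon>, symmetric]) (simp add: restr_def)
  qed
  moreover have "bij_betw (\<phi> z \<circ> \<epsilon> z) (sp (submod ?N K0) z) (sp (L \<kappa>) z)" if "cls z = X" for z
    using bij_betw_trans[OF K0_full(2)[OF that] bij[OF that]] K0_full(1)[OF that] by simp
  ultimately have iso: "mod_iso sV G (submod ?N K0) (L \<kappa>)"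
    using simple_iso[OF simple' L _ low] by blast
  \<comment> \<open>\<open>K0\<close> contains all values on \<open>X\<close>, so \<open>P\<close>,
    and with it the subquotient \<open>Q\<close>, vanishes on \<open>X\<close>; elsewhere they can
    be non-zero only above \<open>X\<close>. Hence the lowest class of \<open>Q\<close> is strictly
    above \<open>X\<close>, and \<open>simple_classification\<close> makes it the support of a
    weight.\<close>
  have constituent: "\<exists>\<mu>\<in>weights sV G U D. mod_iso sV G Q (L \<mu>) \<and>
      (X, supp (S \<mu>)) \<in> ord \<and> X \<noteq> supp (S \<mu>)"
    if P: "is_quotient sV G ?N K0 P" and Q: "simple_constituent sV G P Q" for P Q
  proof -
    have Qs: "simple_module sV G Q" using Q by (simp add: simple_constituent_def)
    obtain A \<pi> where A: "is_submodule sV G P A" and \<pi>: "is_mod_hom sV G (submod P A) Q \<pi>"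
      and \<pi>_surj: "\<And>z. \<pi> z ` A z = sp Q z"
      using Q unfolding simple_constituent_def is_quotient_def submod_simps
      by (elim conjE exE) (rule that, assumption+, simp)
    obtain \<rho> where \<rho>: "is_mod_hom sV G ?N P \<rho>" and \<rho>_surj: "\<And>z. \<rho> z ` sp ?N z = sp P z"
      and \<rho>_ker: "\<And>z. {v \<in> sp ?N z. \<rho> z v = 0} = K0 z"
      using P unfolding is_quotient_def by (elim conjE exE) (rule that, assumption, simp_all)
    have A0: "0 \<in> A z" "A z \<subseteq> sp P z" for z
      using A V.subspace_0[of "A z"] by (simp_all add: is_submodule_def)
    have Q_zero: "sp Q z = {0}" if "sp P z = {0}" for z
    proof -
      have "A z \<subseteq> {0}" using A0(2)[of z] unfolding that .
      then have "A z = {0}" using A0(1)[of z] by blast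
      then show ?thesis
        using \<pi>_surj[of z] mod_hom_zero[OF \<pi>, of z] A0(1)[of z] by simp
    qed
    have P_zero: "sp P z = {0}" if "cls z = X \<or> sp ?N z = {0}" for z
    proof -
      have "v \<in> K0 z" if v: "v \<in> sp ?N z" for v
        using \<open>cls z = X \<or> sp ?N z = {0}\<close>
      proof
        assume "cls z = X"
        then show ?thesis using v K0_full(1)[of z] by simp
      next
        assume "sp ?N z = {0}"
        then show ?thesis using v K0 V.subspace_0[of "K0 z"] by (simp add: is_submodule_def)
      qed
      then have "\<rho> z v = 0" if "v \<in> sp ?N z" for v
        using that \<rho>_ker[of z] by blast
      then have "\<rho> z ` sp ?N z = {0}" using zero_in_sp[OF N, of z] by force
      then show ?thesis using \<rho>_surj by simp
    qed
    obtain Y where Y: "lowest Q Y" by (rule lowest_exists[OF Qs])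
    then obtain y where y: "cls y = Y" "sp Q y \<noteq> {0}" by (auto simp: lowest_def)
    then have "cls y \<noteq> X" "sp ?N y \<noteq> {0}" using Q_zero[of y] P_zero[of y] by metis+
    then have XY: "(X, Y) \<in> ord" "X \<noteq> Y" using above[of y] y(1) by simp_all
    obtain \<mu> where "\<mu> \<in> weights sV G U D" "mod_iso sV G Q (L \<mu>)" "supp (S \<mu>) = Y"
      using simple_classification[OF assms(4,5,6) Qs Y] by (elim bexE conjE) (rule that)
    then show ?thesis using XY by (intro bexI[of _ \<mu>]) simp_all
  qed
  show ?thesis
  proof (intro conjI allI impI)
    show "\<exists>!K. simple_submodule sV G ?N K"
      using simple unique by (rule ex1I)
  next
    fix K assume "simple_submodule sV G ?N K"
    then have K: "K = K0" by (rule unique)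
    show "mod_iso sV G (submod ?N K) (L \<kappa>)" unfolding K by (rule iso)
    fix P Q assume PQ: "is_quotient sV G ?N K P \<and> simple_constituent sV G P Q"
    show "\<exists>\<mu>\<in>weights sV G U D. mod_iso sV G Q (L \<mu>) \<and>
        (supp (S \<kappa>), supp (S \<mu>)) \<in> ord \<and> supp (S \<kappa>) \<noteq> supp (S \<mu>)"
      using PQ unfolding K by (elim conjE) (rule constituent[unfolded X_def])
  qed
qed

end
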